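(* Let $X$ be a squared $\kappa$-$\mu$ shadowed random variable with mean $\bar\gamma>0$ and shape parameters $\kappa,\mu,m$, and let $\hat X$ be a squared $\kappa$-$\mu$ shadowed random variable with mean $\widetilde\gamma>0$ and shape parameters $\hat\kappa,\hat\mu,\hat m$, where $\kappa,\hat\kappa$ are arbitrary non-negative real numbers and $\mu,m,\hat\mu,\hat m$ are positive integers. Assume $X$ and $\hat X$ are independent (not necessarily identically distributed). Let $M,(C_j,m_j,\Omega_j)_{0\le j\le M}$ be the mixture parameters associated with $(\bar\gamma,\kappa,\mu,m)$, and $\hat M,(\hat C_h,\hat m_h,\hat\Omega_h)_{0\le h\le\hat M}$ those associated with $(\widetilde\gamma,\hat\kappa,\hat\mu,\hat m)$. Then $Z=X\hat X$ has cumulative distribution function, for $z>0$, $$F_Z(z)=\sum_{j=0}^{M}\sum_{h=0}^{\hat M} C_j\hat C_h\left[1-\sum_{k=0}^{m_j-1}\frac{2}{k!\,\Gamma(\hat m_h)}\left(\frac{z}{\Omega_j\hat\Omega_h}\right)^{\frac{k+\hat m_h}{2}}K_{\hat m_h-k}\!\left(\sqrt{\frac{4z}{\Omega_j\hat\Omega_h}}\right)\right],$$ where $K_\nu$ is the modified Bessel function of the second kind.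
   Context: Squared $\kappa$-$\mu$ shadowed distribution: a positive random variable $\gamma$ is a squared $\kappa$-$\mu$ shadowed random variable with mean $\bar\gamma>0$ and shape parameters $\kappa\ge 0$, $\mu>0$, $m>0$ if it has density, for $x>0$, $$f(x)=\frac{\mu^\mu m^m(1+\kappa)^\mu}{\Gamma(\mu)\,\bar\gamma\,(\mu\kappa+m)^m}\left(\frac{x}{\bar\gamma}\right)^{\mu-1}e^{-\frac{\mu(1+\kappa)x}{\bar\gamma}}\;{}_1F_1\!\left(m;\mu;\frac{\mu^2\kappa(1+\kappa)}{\mu\kappa+m}\frac{x}{\bar\gamma}\right),$$ where ${}_1F_1$ is the Kummer confluent hypergeometric function. Mixture parameters associated with $(\bar\gamma,\kappa,\mu,m)$ ($\mu,m$ positive integers): put $p=\frac{m}{\mu\kappa+m}$, $q=\frac{\mu\kappa}{\mu\kappa+m}$, $\Delta_1=\frac{\bar\gamma}{\mu(1+\kappa)}$, $\Delta_2=\frac{\mu\kappa+m}{m}\cdot\frac{\bar\gamma}{\mu(1+\kappa)}$. Case $\mu>m$: $M=\mu$, and - for $i=0$: $C_0=0$, $m_0=\mu-m+1$, $\Omega_0=\Delta_1$; - for $0<i\le\mu-m$: $C_i=(-1)^m\binom{m+i-2}{i-1}p^{m}q^{-m-i+1}$, $m_i=\mu-m-i+1$, $\Omega_i=\Delta_1$; - for $\mu-m<i\le\mu$: $C_i=(-1)^{i-\mu+m-1}\binom{i-2}{i-\mu+m-1}p^{\,i-\mu+m-1}q^{-i+1}$, $m_i=\mu-i+1$, $\Omega_i=\Delta_2$.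 Case $\mu\le m$: $M=m-\mu$, and for $0\le i\le M$: $C_i=\binom{m-\mu}{i}p^{i}q^{\,m-\mu-i}$ (with $0^0=1$), $m_i=m-i$, $\Omega_i=\Delta_2$. The hatted parameters $\hat M,\hat C_h,\hat m_h,\hat\Omega_h$ are obtained by the same formulas with $(\bar\gamma,\kappa,\mu,m)$ replaced by $(\widetilde\gamma,\hat\kappa,\hat\mu,\hat m)$.
   Formalization: When κ=0 and μ>m (or likewise for the hatted parameters), the weights contain negative powers of q=0 and are undefined; there the formula is replaced by F_Z(z) being the limit of the right-hand side as the parameters tend to (κ, κ̂) from values where the weights are defined. *)

theory Defs
  imports "HOL-Probability.Probability"
begin

definition kummer_1F1 :: "real \<Rightarrow> real \<Rightarrow> real \<Rightarrow> real" where
  "kummer_1F1 a b x = (\<Sum>n. pochhammer a n / pochhammer b n * x ^ n / fact n)"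

(* The classical integral for K_nu(x), x > 0, real order nu. *)
definition bessel_K :: "real \<Rightarrow> real \<Rightarrow> real" where
  "bessel_K \<nu> x = (LBINT t:{0..}. exp (- x * cosh t) * cosh (\<nu> * t))"

definition kms_density :: "real \<Rightarrow> real \<Rightarrow> real \<Rightarrow> real \<Rightarrow> real \<Rightarrow> real" where
  "kms_density g \<kappa> \<mu> m x =
     (if x > 0 then
        \<mu> powr \<mu> * m powr m * (1 + \<kappa>) powr \<mu> / (Gamma \<mu> * g * (\<mu> * \<kappa> + m) powr m)
        * (x / g) powr (\<mu> - 1) * exp (- (\<mu> * (1 + \<kappa>) * x / g))
        * kummer_1F1 m \<mu> (\<mu>\<^sup>2 * \<kappa> * (1 + \<kappa>) / (\<mu> * \<kappa> + m) * (x / g))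
      else 0)"

definition squared_kappa_mu_shadowed ::
  "'a measure \<Rightarrow> ('a \<Rightarrow> real) \<Rightarrow> real \<Rightarrow> real \<Rightarrow> real \<Rightarrow> real \<Rightarrow> bool" where
  "squared_kappa_mu_shadowed P X g \<kappa> \<mu> m \<longleftrightarrow>
     g > 0 \<and> \<kappa> \<ge> 0 \<and> \<mu> > 0 \<and> m > 0 \<and>
     distributed P lborel X (\<lambda>x. ennreal (kms_density g \<kappa> \<mu> m x))"

definition mix_p :: "real \<Rightarrow> nat \<Rightarrow> nat \<Rightarrow> real" where
  "mix_p \<kappa> \<mu> m = real m / (real \<mu> * \<kappa> + real m)"

definition mix_q :: "real \<Rightarrow> nat \<Rightarrow> nat \<Rightarrow> real" where
  "mix_q \<kappa> \<mu> m = real \<mu> * \<kappa> / (real \<mu> * \<kappa> + real m)"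

definition mix_Delta1 :: "real \<Rightarrow> real \<Rightarrow> nat \<Rightarrow> real" where
  "mix_Delta1 g \<kappa> \<mu> = g / (real \<mu> * (1 + \<kappa>))"

definition mix_Delta2 :: "real \<Rightarrow> real \<Rightarrow> nat \<Rightarrow> nat \<Rightarrow> real" where
  "mix_Delta2 g \<kappa> \<mu> m = (real \<mu> * \<kappa> + real m) / real m * (g / (real \<mu> * (1 + \<kappa>)))"

definition mix_M :: "nat \<Rightarrow> nat \<Rightarrow> nat" where
  "mix_M \<mu> m = (if \<mu> > m then \<mu> else m - \<mu>)"

(* For m < \<mu> and \<kappa> = 0 the weights involve negative powers of q = 0 and are
   undefined on paper; here they take the junk value 0. See mix_dom. *)
definition mix_C :: "real \<Rightarrow> nat \<Rightarrow> nat \<Rightarrow> nat \<Rightarrow> real" where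
  "mix_C \<kappa> \<mu> m i =
     (let p = mix_p \<kappa> \<mu> m; q = mix_q \<kappa> \<mu> m in
      if \<mu> > m then
        (if i = 0 then 0
         else if i \<le> \<mu> - m then
           (- 1) ^ m * real ((m + i - 2) choose (i - 1)) * p ^ m
             * q powi (- int m - int i + 1)
         else
           (- 1) ^ (i + m - \<mu> - 1) * real ((i - 2) choose (i + m - \<mu> - 1))
             * p ^ (i + m - \<mu> - 1) * q powi (- int i + 1))
      else real ((m - \<mu>) choose i) * p ^ i * q ^ (m - \<mu> - i))"

definition mix_m :: "nat \<Rightarrow> nat \<Rightarrow> nat \<Rightarrow> nat" where
  "mix_m \<mu> m i =
     (if \<mu> > m then (if i \<le> \<mu> - m then \<mu> - m - i + 1 else \<mu> - i + 1)
      else m - i)"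

definition mix_Omega :: "real \<Rightarrow> real \<Rightarrow> nat \<Rightarrow> nat \<Rightarrow> nat \<Rightarrow> real" where
  "mix_Omega g \<kappa> \<mu> m i =
     (if \<mu> > m \<and> i \<le> \<mu> - m then mix_Delta1 g \<kappa> \<mu> else mix_Delta2 g \<kappa> \<mu> m)"

(* The values of \<kappa> for which all the weights mix_C are defined on paper. *)
definition mix_dom :: "nat \<Rightarrow> nat \<Rightarrow> real set" where
  "mix_dom \<mu> m = {\<kappa>. \<kappa> \<ge> 0 \<and> (\<mu> > m \<longrightarrow> \<kappa> > 0)}"

end

theory Submission
  imports Defs
begin

text \<open>
  In the variable \<open>y = x / \<Delta>\<^sub>1\<close> the power series of the density times \<open>exp y\<close> has the generating
  function \<open>p\<^sup>m t\<^sup>\<mu> / (1 - q t)\<^sup>m\<close>, where an Erlang density of shape \<open>k\<close> and scale \<open>\<Delta>\<^sub>1\<close> or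
  \<open>\<Delta>\<^sub>2\<close> corresponds to \<open>t\<^sup>k\<close> or \<open>(p t / (1 - q t))\<^sup>k\<close>. The weights \<open>C\<^sub>i\<close> are thus the coefficients of
  a binomial expansion if \<open>\<mu> \<le> m\<close> and of a partial fraction decomposition if \<open>\<mu> > m\<close>.
  Integrating the tail of one Erlang variable against the density of another gives
  \<open>\<integral> y powr (\<nu> - 1) * exp (- b * y - c / y)\<close>, which the substitution \<open>y = sqrt (c / b) * exp t\<close>
  turns into the integral of \<open>K\<^sub>\<nu>\<close>. The limit, which matters where the weights are singular,
  follows by dominated convergence, since the distribution function of the product depends
  continuously on the shape parameters.
\<close>

subsection \<open>Products of Erlang variables and the Bessel function\<close>

text \<open>Folding the line at 0 pairs \<open>t\<close> with \<open>- t\<close>: the factor with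
  \<open>cosh t\<close> is even, and the two exponentials in \<open>\<nu> * t\<close> add up to
  twice a hyperbolic cosine.\<close>

lemma bessel_K_eq_integral:
  fixes \<nu> w :: real
  assumes int: "integrable lborel (\<lambda>t. exp (\<nu> * t - w * cosh t))"
  shows "(\<integral>t. exp (\<nu> * t - w * cosh t) \<partial>lborel) = 2 * bessel_K \<nu> w"
proof -
  define h where "h = (\<lambda>t::real. exp (\<nu> * t - w * cosh t))"
  have hi: "integrable lborel h" using int by (simp add: h_def)
  have hri: "integrable lborel (\<lambda>t. h (- t))"
    using lborel_integrable_real_affine[OF hi, of "-1" 0] by simp
  have [measurable]: "h \<in> borel_measurable borel" "(\<lambda>t. h (- t)) \<in> borel_measurable borel"
    using borel_measurable_integrable[OF hi] borel_measurable_integrable[OF hri] by simp_all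
  have mult: "integrable lborel (\<lambda>t. indicator A t * k t)"
    if "integrable lborel k" "A \<in> sets borel" for A and k :: "real \<Rightarrow> real"
    using integrable_mult_indicator[of A lborel k] that by simp
  have "(\<integral>t. h t \<partial>lborel) = (\<integral>t. indicator {0..} t * h t + indicator {..<0} t * h t \<partial>lborel)"
    by (intro Bochner_Integration.integral_cong) (auto simp: indicator_def)
  also have "\<dots> = (\<integral>t. indicator {0..} t * h t \<partial>lborel) + (\<integral>t. indicator {..<0} t * h t \<partial>lborel)"
    by (intro Bochner_Integration.integral_add mult hi) auto
  also have "(\<integral>t. indicator {..<0} t * h t \<partial>lborel)
    = (\<integral>t. indicator {..<0} (- t) * h (- t) \<partial>lborel)"
    using lborel_integral_real_affine[of "-1" "\<lambda>t. indicator {..<0} t * h t" 0] by simp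
  also have "\<dots> = (\<integral>t. indicator {0..} t * h (- t) \<partial>lborel)"
  proof (rule integral_cong_AE)
    show "AE t in lborel. indicator {..<0} (- t) * h (- t) = indicator {0..} t * h (- t)"
      using AE_lborel_singleton[of 0] by eventually_elim (auto simp: indicator_def)
  qed measurable
  also have "(\<integral>t. indicator {0..} t * h t \<partial>lborel) + (\<integral>t. indicator {0..} t * h (- t) \<partial>lborel)
     = (\<integral>t. indicator {0..} t * h t + indicator {0..} t * h (- t) \<partial>lborel)"
    by (intro Bochner_Integration.integral_add[symmetric] mult hi hri) auto
  also have "\<dots> = (\<integral>t. 2 * (indicator {0..} t * (exp (- w * cosh t) * cosh (\<nu> * t))) \<partial>lborel)"
  proof -
    have "h t + h (- t) = 2 * (exp (- w * cosh t) * cosh (\<nu> * t))" for t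
    proof -
      have "h t = exp (- w * cosh t) * exp (\<nu> * t)" "h (- t) = exp (- w * cosh t) * exp (- (\<nu> * t))"
        by (simp_all add: h_def flip: exp_add)
      then show ?thesis unfolding cosh_field_def[of "\<nu> * t"] by (simp add: distrib_left)
    qed
    then show ?thesis
      by (intro Bochner_Integration.integral_cong) (simp_all flip: distrib_left)
  qed
  finally show ?thesis
    by (simp add: h_def bessel_K_def set_lebesgue_integral_def)
qed

text \<open>The scale \<open>s = sqrt (c / b)\<close> balances the two exponents:
  \<open>b * s\<close> and \<open>c / s\<close> both equal half of \<open>w\<close>, so under
  \<open>y = s * exp t\<close> they merge into \<open>- w * cosh t\<close>. Integrability is a
  hypothesis because callers get it by comparison with a density, and it carries over to the new
  variable.\<close>

lemma integral_powr_exp_eq_bessel_K: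
  fixes \<nu> b c :: real
  assumes "b > 0" "c > 0"
  assumes int: "integrable lborel (\<lambda>y. indicator {0<..} y * (y powr (\<nu> - 1) * exp (- b * y - c
    / y)))"
  shows "(\<integral>y. indicator {0<..} y * (y powr (\<nu> - 1) * exp (- b * y - c / y)) \<partial>lborel)
    = 2 * (c / b) powr (\<nu> / 2) * bessel_K \<nu> (2 * sqrt (b * c))"
proof -
  define f where "f = (\<lambda>y. y powr (\<nu> - 1) * exp (- b * y - c / y))"
  define s where "s = sqrt (c / b)"
  define w where "w = 2 * sqrt (b * c)"
  have s: "s > 0" using assms by (simp add: s_def)
  have bs: "b * s = w / 2" and cs: "c / s = w / 2"
    using assms by (auto simp: s_def w_def real_sqrt_divide real_sqrt_mult field_simps simp flip:
      power2_eq_square)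
  have img: "range (\<lambda>t. s * exp t) = {0<..}"
  proof -
    have "y \<in> range (\<lambda>t. s * exp t)" if "y > 0" for y
      using s that by (intro image_eqI[of _ _ "ln (y / s)"]) auto
    then show ?thesis using s by auto
  qed
  have sub: "s * exp t * f (s * exp t) = s powr \<nu> * exp (\<nu> * t - w * cosh t)" for t
  proof -
    have "s * exp t * (s * exp t) powr (\<nu> - 1) = (s * exp t) powr \<nu>"
      using s by (simp add: powr_diff)
    also have "\<dots> = s powr \<nu> * exp (\<nu> * t)"
      using s by (simp add: powr_mult powr_def[of "exp t"])
    finally have 1: "s * exp t * (s * exp t) powr (\<nu> - 1) = s powr \<nu> * exp (\<nu> * t)" .
    have "- b * (s * exp t) - c / (s * exp t) = - (b * s) * exp t - (c / s) * exp (- t)"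
      by (simp add: exp_minus field_simps)
    also have "\<dots> = - w * cosh t"
      unfolding bs cs by (simp add: cosh_field_def field_simps)
    finally have 2: "- b * (s * exp t) - c / (s * exp t) = - w * cosh t" .
    have "s * exp t * f (s * exp t) = s powr \<nu> * exp (\<nu> * t) * exp (- w * cosh t)"
      unfolding f_def 2 using 1 by simp
    then show ?thesis by (simp add: exp_diff exp_minus field_simps)
  qed
  have si: "set_integrable lborel {0<..} f"
    using int by (simp add: set_integrable_def f_def)
  \<comment> \<open>The change of variables theorem speaks of absolute integrability, so the
    integrand passes from \<open>lborel\<close> to its completion here and returns in
    \<open>L\<close>.\<close>
  have ai: "f absolutely_integrable_on {0<..}"
    using si by (simp add: set_integrable_def integrable_completion f_def)
  have [measurable]: "(cosh :: real \<Rightarrow> real) \<in> borel_measurable borel"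
    by (intro borel_measurable_continuous_onI continuous_intros)
  have "(\<lambda>t. \<bar>s * exp t\<bar> * f (s * exp t)) absolutely_integrable_on UNIV \<and>
      integral UNIV (\<lambda>t. \<bar>s * exp t\<bar> * f (s * exp t)) = integral {0<..} f"
    by (subst has_absolute_integral_change_of_variables_1'[where g = "\<lambda>t. s * exp t"])
       (use s ai img in \<open>auto intro!: derivative_eq_intros inj_onI\<close>)
  moreover have "(\<lambda>t. \<bar>s * exp t\<bar> * f (s * exp t)) = (\<lambda>t. s powr \<nu> * exp (\<nu> * t - w * cosh t))"
    using s by (simp add: sub abs_mult)
  ultimately have A: "(\<lambda>t. s powr \<nu> * exp (\<nu> * t - w * cosh t)) absolutely_integrable_on UNIV"
    and I: "integral UNIV (\<lambda>t. s powr \<nu> * exp (\<nu> * t - w * cosh t)) = integral {0<..} f"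
    by simp_all
  have L: "integrable lborel (\<lambda>t. s powr \<nu> * exp (\<nu> * t - w * cosh t))"
    using A by (simp add: set_integrable_def integrable_completion)
  then have L': "integrable lborel (\<lambda>t. exp (\<nu> * t - w * cosh t))"
    using s by simp
  have "(\<integral>y. indicator {0<..} y * f y \<partial>lborel) = integral {0<..} f"
    using set_borel_integral_eq_integral(2)[OF si] by (simp add: set_lebesgue_integral_def)
  also have "\<dots> = (\<integral>t. s powr \<nu> * exp (\<nu> * t - w * cosh t) \<partial>lborel)"
    using integral_lborel[OF L] I by (simp only:)
  also have "\<dots> = s powr \<nu> * (2 * bessel_K \<nu> w)"
    using bessel_K_eq_integral[OF L'] by simp
  also have "s powr \<nu> = (c / b) powr (\<nu> / 2)"
    using assms by (simp add: s_def powr_half_sqrt[symmetric] powr_powr)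
  finally show ?thesis by (simp add: f_def w_def)
qed

section \<open>The distribution function of a product as a functional of two densities\<close>

definition product_region :: "real \<Rightarrow> (real \<times> real) set" where
  "product_region z = {p. 0 < fst p \<and> 0 < snd p \<and> fst p * snd p \<le> z}"

text \<open>A functional of functions rather than of random variables: it is bilinear, so mixture
  weights of either sign are allowed, and it passes to limits by dominated convergence.\<close>

definition product_cdf :: "real \<Rightarrow> (real \<Rightarrow> real) \<Rightarrow> (real \<Rightarrow> real) \<Rightarrow> real" where
  "product_cdf z f f' =
     (\<integral>p. indicator (product_region z) p * (f (fst p) * f' (snd p)) \<partial>(lborel \<Otimes>\<^sub>M lborel))"

lemma product_region_measurable [measurable]: "product_region z \<in> sets (borel \<Otimes>\<^sub>M borel)"
proof -
  have "product_region z = {p \<in> space (borel \<Otimes>\<^sub>M borel). 0 < fst p \<and> 0 < snd p \<and> fst p * snd p \<le> z}"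
    by (auto simp: product_region_def space_pair_measure)
  then show ?thesis by simp
qed

lemma integrable_product_density:
  fixes f f' :: "real \<Rightarrow> real"
  assumes f: "integrable lborel f" and f': "integrable lborel f'"
  shows "integrable (lborel \<Otimes>\<^sub>M lborel) (\<lambda>p. f (fst p) * f' (snd p))"
proof -
  note [measurable] = borel_measurable_integrable[OF f] borel_measurable_integrable[OF f']
  show ?thesis
    by (rule lborel_pair.Fubini_integrable) (use f f' in \<open>auto simp: abs_mult\<close>)
qed

lemma integrable_product_cdf:
  fixes f f' :: "real \<Rightarrow> real"
  assumes f: "integrable lborel f" and f': "integrable lborel f'"
  shows "integrable (lborel \<Otimes>\<^sub>M lborel)
           (\<lambda>p. indicator (product_region z) p * (f (fst p) * f' (snd p)))"
  using integrable_mult_indicator[OF _ integrable_product_density[OF f f'], of "product_region z"]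
  by simp

text \<open>Bilinearity. The expansions are required for positive arguments only, because the region
  lies in the open positive quadrant.\<close>

lemma product_cdf_sum:
  fixes f f' :: "'i \<Rightarrow> real \<Rightarrow> real"
  assumes "\<And>i. integrable lborel (f i)" "\<And>i. integrable lborel (f' i)"
    and "\<And>x. x > 0 \<Longrightarrow> u x = (\<Sum>i\<in>I. c i * f i x)"
    and "\<And>x. x > 0 \<Longrightarrow> u' x = (\<Sum>i\<in>I'. c' i * f' i x)"
  shows "product_cdf z u u' = (\<Sum>i\<in>I. \<Sum>j\<in>I'. c i * c' j * product_cdf z (f i) (f' j))"
proof -
  have "product_cdf z u u' = (\<integral>p. (\<Sum>i\<in>I. \<Sum>j\<in>I'. c i * c' j *
     (indicator (product_region z) p * (f i (fst p) * f' j (snd p)))) \<partial>(lborel \<Otimes>\<^sub>M lborel))"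
    unfolding product_cdf_def
  proof (intro Bochner_Integration.integral_cong refl)
    fix p :: "real \<times> real"
    show "indicator (product_region z) p * (u (fst p) * u' (snd p)) = (\<Sum>i\<in>I. \<Sum>j\<in>I'. c i * c' j *
     (indicator (product_region z) p * (f i (fst p) * f' j (snd p))))"
      using assms(3)[of "fst p"] assms(4)[of "snd p"]
      by (auto simp: indicator_def product_region_def sum_product intro!: sum.cong)
  qed
  also have "\<dots> = (\<Sum>i\<in>I. \<Sum>j\<in>I'. c i * c' j * product_cdf z (f i) (f' j))"
    by (simp add: Bochner_Integration.integral_sum integrable_product_cdf assms product_cdf_def
      Bochner_Integration.integrable_sum)
  finally show ?thesis .
qed

section \<open>Integrals against Erlang densities; the index \<open>k\<close> stands for shape
  \<open>Suc k\<close>, and \<open>l\<close> is the rate\<close>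

lemma integrable_erlang_density:
  assumes "l > 0"
  shows "integrable lborel (erlang_density k l)"
  and "(\<integral>x. erlang_density k l x \<partial>lborel) = 1"
proof -
  have "has_bochner_integral lborel (erlang_density k l) 1"
    by (rule has_bochner_integral_nn_integral)
       (use assms nn_integral_erlang_ith_moment[OF assms, of k 0] in auto)
  then show "integrable lborel (erlang_density k l)"  "(\<integral>x. erlang_density k l x \<partial>lborel) = 1"
    by (auto simp: has_bochner_integral_iff)
qed

lemma integral_erlang_density_le:
  assumes "l > 0"
  shows "(\<integral>x. indicator {0<..a} x * erlang_density k l x \<partial>lborel) = erlang_CDF k l a"
proof -
  have "has_bochner_integral lborel (\<lambda>x. erlang_density k l x *
    indicator {..a} x) (erlang_CDF k l a)"
    by (rule has_bochner_integral_nn_integral)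
       (use assms nn_integral_erlang_density[OF assms, of k a]
         in \<open>auto simp: ennreal_mult' ennreal_indicator\<close>)
  then have "(\<integral>x. erlang_density k l x * indicator {..a} x \<partial>lborel) = erlang_CDF k l a"
    by (simp add: has_bochner_integral_iff)
  also have "(\<integral>x. erlang_density k l x * indicator {..a} x \<partial>lborel) =
    (\<integral>x. indicator {0<..a} x * erlang_density k l x \<partial>lborel)"
  \<comment> \<open>For \<open>k = 0\<close> the density has the value \<open>l\<close> at 0, so the
    integrands agree only almost everywhere.\<close>
  proof (rule integral_cong_AE)
    show "AE x in lborel. erlang_density k l x * indicator {..a} x
      = indicator {0<..a} x * erlang_density k l x"
      using AE_lborel_singleton[of 0]
      by eventually_elim (auto simp: indicator_def erlang_density_def)
  qed measurable
  finally show ?thesis by simp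
qed

text \<open>The last factor of \<open>h\<close> is the Poisson probability of \<open>k\<close> with
  parameter \<open>c / y\<close>, which is one term of an Erlang tail. Being at most 1, it leaves
  \<open>h\<close> integrable; collecting the powers of \<open>y\<close> gives a Bessel integral of
  order \<open>Suc b - k\<close>.\<close>

lemma integral_erlang_density_bessel:
  fixes a b k :: nat and l c :: real
  assumes l: "l > 0" and c: "c > 0"
  defines "h \<equiv> (\<lambda>y. indicator {0<..} y * (erlang_density b l y * ((c / y) ^ k * exp (- (c / y))
    / fact k)))"
  shows "integrable lborel h"
    and "(\<integral>y. h y \<partial>lborel) = 2 / (fact k * Gamma (real (Suc b)))
       * (c * l) powr ((real k + real (Suc b)) / 2) * bessel_K (real (Suc b) - real k) (sqrt (4 * (c
         * l)))"
proof -
  \<comment> \<open>A single term of the exponential series is at most its sum.\<close>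
  have le1: "w ^ k * exp (- w) / fact k \<le> 1" if "w \<ge> 0" for w :: real
  proof -
    have "w ^ k / fact k \<le> exp w"
    proof -
      have "(\<Sum>n\<in>{k}. w ^ n /\<^sub>R fact n) \<le> (\<Sum>n. w ^ n /\<^sub>R fact n)"
        by (rule sum_le_suminf) (use that summable_exp[of w] in \<open>auto simp: divide_inverse\<close>)
      then show ?thesis by (simp add: exp_def divide_inverse mult.commute)
    qed
    then show ?thesis by (simp add: exp_minus field_simps)
  qed
  show int: "integrable lborel h"
  proof (rule Bochner_Integration.integrable_bound[OF integrable_erlang_density(1)[OF l, of b]])
    show "AE y in lborel. norm (h y) \<le> norm (erlang_density b l y)"
    proof (rule AE_I2)
      fix y :: real
      show "norm (h y) \<le> norm (erlang_density b l y)"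
        using le1[of "c / y"] l c mult_left_mono[OF le1[of "c / y"], of "erlang_density b l y"]
        by (auto simp: h_def indicator_def abs_mult power_abs[symmetric] simp del:
          times_divide_eq_right)
    qed
  qed (auto simp: h_def)
  define \<nu> where "\<nu> = real (Suc b) - real k"
  define C where "C = l ^ Suc b * c ^ k / (fact b * fact k)"
  have C: "C > 0" using l c by (simp add: C_def)
  have h_eq: "h = (\<lambda>y. C * (indicator {0<..} y * (y powr (\<nu> - 1) * exp (- l * y - c / y))))"
  proof
    fix y :: real
    have "y powr (\<nu> - 1) = y ^ b / y ^ k" if "y > 0"
      using that by (simp add: \<nu>_def powr_diff powr_realpow)
    then show "h y = C * (indicator {0<..} y * (y powr (\<nu> - 1) * exp (- l * y - c / y)))"
      by (simp add: h_def C_def erlang_density_def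
        indicator_def power_divide exp_diff exp_minus field_simps)
  qed
  have "integrable lborel (\<lambda>y. indicator {0<..} y * (y powr (\<nu> - 1) * exp (- l * y - c / y)))"
    using int C unfolding h_eq by simp
  from integral_powr_exp_eq_bessel_K[OF l c this]
  have "(\<integral>y. h y \<partial>lborel) = C * (2 * (c / l) powr (\<nu> / 2) * bessel_K \<nu> (2 * sqrt (l * c)))"
    unfolding h_eq by simp
  also have "2 * sqrt (l * c) = sqrt (4 * (c * l))"
    by (simp add: real_sqrt_mult mult.commute)
  also have "C * (2 * (c / l) powr (\<nu> / 2) * bessel_K \<nu> (sqrt (4 * (c * l))))
    = 2 / (fact k * fact b) * (l powr real (Suc b) * c powr real k * (c / l) powr (\<nu> / 2))
      * bessel_K \<nu> (sqrt (4 * (c * l)))"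
    using l c by (simp add: C_def powr_realpow del: of_nat_Suc power_Suc) (simp add: mult_ac)
  \<comment> \<open>Splitting the quotient shifts half of \<open>\<nu>\<close> from one exponent to
    the other. Both then equal the mean of \<open>k\<close> and \<open>Suc b\<close>, so the two
    powers merge into one of \<open>c * l\<close>.\<close>
  also have "l powr real (Suc b) * c powr real k * (c / l) powr (\<nu> / 2) =
      l powr (real (Suc b) - \<nu> / 2) * c powr (real k + \<nu> / 2)"
    using l c by (simp add: powr_divide powr_diff powr_add del: of_nat_Suc)
  also have "real (Suc b) - \<nu> / 2 = (real k + real (Suc b)) / 2"
    by (simp add: \<nu>_def field_simps)
  also have "real k + \<nu> / 2 = (real k + real (Suc b)) / 2"
    by (simp add: \<nu>_def field_simps)
  also have "l powr ((real k + real (Suc b)) / 2) * c powr ((real k + real (Suc b)) / 2)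
    = (c * l) powr ((real k + real (Suc b)) / 2)"
    using l c by (simp add: powr_mult mult.commute)
  also have "fact b = Gamma (real (Suc b))"
    by (simp add: Gamma_fact[symmetric] del: of_nat_Suc) (simp add: add.commute)
  finally show "(\<integral>y. h y \<partial>lborel) = 2 / (fact k * Gamma (real (Suc b)))
       * (c * l) powr ((real k + real (Suc b)) / 2) * bessel_K (real (Suc b) - real k) (sqrt (4 * (c
         * l)))"
    by (simp add: \<nu>_def)
qed

text \<open>By Fubini, for fixed \<open>y\<close> the inner integral is an Erlang distribution
  function at \<open>z / y\<close>, that is, 1 minus Poisson probabilities with parameter
  \<open>z * l / y\<close>; each of these integrates to a Bessel term.\<close>

lemma product_cdf_erlang:
  fixes a b :: nat and l l' z :: real
  assumes l: "l > 0" and l': "l' > 0" and z: "z > 0"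
  shows "product_cdf z (erlang_density a l) (erlang_density b l') =
    1 - (\<Sum>k=0..a. 2 / (fact k * Gamma (real (Suc b))) * (z * l * l') powr ((real k + real (Suc b))
      / 2)
       * bessel_K (real (Suc b) - real k) (sqrt (4 * (z * l * l'))))"
proof -
  define h where "h = (\<lambda>k y. indicator {0<..} y * (erlang_density b l' y * (((z * l) / y) ^ k
    * exp (- ((z * l) / y)) / fact k)))"
  have hi: "integrable lborel (h k)" for k
    unfolding h_def using l l' z by (intro integral_erlang_density_bessel) auto
  have hint: "(\<integral>y. h k y \<partial>lborel) = 2 / (fact k * Gamma (real (Suc b)))
       * (z * l * l') powr ((real k + real (Suc b)) / 2) * bessel_K (real (Suc b) - real k) (sqrt (4
         * (z * l * l')))" for k
    unfolding h_def using l l' z by (intro integral_erlang_density_bessel) auto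
  define H where "H = (\<lambda>x y. indicator (product_region z) (x, y) * (erlang_density a l x
    * erlang_density b l' y))"
  have Hi: "integrable (lborel \<Otimes>\<^sub>M lborel) (case_prod H)"
    using integrable_product_cdf[OF integrable_erlang_density(1)[OF l, of a]
      integrable_erlang_density(1)[OF l', of b], of z]
    by (simp add: H_def case_prod_beta')
  have inner: "(\<integral>x. H x y \<partial>lborel) = indicator {0<..} y * erlang_density b l' y - (\<Sum>k=0..a. h k y)"
    for y
  proof (cases "y > 0")
    case True
    have "H x y = erlang_density b l' y * (indicator {0<..z/y} x * erlang_density a l x)" for x
      using True by (auto simp: H_def product_region_def indicator_def field_simps)
    \<comment> \<open>This selects the nonzero branch of \<open>erlang_CDF\<close>.\<close>
    moreover have "\<not> z / y < 0" using True z by (simp add: divide_less_0_iff)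
    ultimately have "(\<integral>x. H x y \<partial>lborel) = erlang_density b l' y * erlang_CDF a l (z / y)"
      by (simp add: integral_erlang_density_le[OF l])
    also have "\<dots> = erlang_density b l' y - (\<Sum>k=0..a. h k y)"
      using True \<open>\<not> z / y < 0\<close> by (simp add: erlang_CDF_def h_def right_diff_distrib
        sum_distrib_left atLeast0AtMost mult.commute[of l])
    finally show ?thesis using True by simp
  qed (simp add: H_def product_region_def h_def)
  have "product_cdf z (erlang_density a l) (erlang_density b l')
    = (\<integral>p. case_prod H p \<partial>(lborel \<Otimes>\<^sub>M lborel))"
    by (simp add: product_cdf_def H_def case_prod_beta')
  also have "\<dots> = (\<integral>y. (\<integral>x. H x y \<partial>lborel) \<partial>lborel)"
    using lborel_pair.integral_snd[OF Hi] by simp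
  also have "\<dots> = (\<integral>y. indicator {0<..} y * erlang_density b l' y - (\<Sum>k=0..a. h k y) \<partial>lborel)"
    by (simp add: inner)
  \<comment> \<open>Without the indicator the first term has total mass 1.\<close>
  also have "\<dots> = (\<integral>y. erlang_density b l' y - (\<Sum>k=0..a. h k y) \<partial>lborel)"
  proof (rule integral_cong_AE)
    show "AE y in lborel. indicator {0<..} y * erlang_density b l' y - (\<Sum>k=0..a. h k y)
      = erlang_density b l' y - (\<Sum>k=0..a. h k y)"
      using AE_lborel_singleton[of 0]
      by eventually_elim (auto simp: indicator_def erlang_density_def)
  qed (use borel_measurable_integrable[OF hi] in measurable)
  also have "\<dots> = 1 - (\<Sum>k=0..a. \<integral>y. h k y \<partial>lborel)"
    by (subst Bochner_Integration.integral_diff)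
       (simp_all add: integrable_erlang_density[OF l'] hi Bochner_Integration.integral_sum
         Bochner_Integration.integrable_sum)
  finally show ?thesis by (simp only: hint)
qed

subsection \<open>Kummer's function\<close>

text \<open>The left side is one term of the binomial series of \<open>1 / (1 - s) ^ Suc m\<close>.
  The induction raises \<open>m\<close> by a convolution with the geometric series, which for the
  coefficients is the hockey-stick identity.\<close>

lemma choose_mult_power_le:
  fixes s :: real
  assumes "0 \<le> s" "s < 1"
  shows "real ((m + n) choose n) * s ^ n \<le> 1 / (1 - s) ^ Suc m"
proof (induction m arbitrary: n)
  case 0
  have "s ^ n \<le> 1" using assms by (simp add: power_le_one)
  also have "1 \<le> 1 / (1 - s)" using assms by simp
  finally show ?case by simp
next
  case (Suc m)
  have "real ((Suc m + n) choose n) = (\<Sum>j\<le>n. real ((m + j) choose j))"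
    using sum_choose_lower[of m n] by (simp add: add.commute flip: of_nat_sum)
  then have "real ((Suc m + n) choose n) * s ^ n
    = (\<Sum>j\<le>n. (real ((m + j) choose j) * s ^ j) * s ^ (n - j))"
    by (simp add: sum_distrib_right mult.assoc flip: power_add)
  also have "\<dots> \<le> (\<Sum>j\<le>n. 1 / (1 - s) ^ Suc m * s ^ (n - j))"
    using assms by (intro sum_mono mult_right_mono Suc) auto
  also have "\<dots> = 1 / (1 - s) ^ Suc m * (\<Sum>j\<le>n. s ^ j)"
  proof -
    have "(\<Sum>j\<le>n. s ^ (n - j)) = (\<Sum>j\<le>n. s ^ j)"
      using sum.nat_diff_reindex[of "\<lambda>j. s ^ j" "Suc n"] by (simp add: lessThan_Suc_atMost)
    then show ?thesis by (simp only: sum_distrib_left[symmetric])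
  qed
  also have "(\<Sum>j\<le>n. s ^ j) = (1 - s ^ Suc n) / (1 - s)"
    using assms by (simp add: sum_gp0)
  also have "1 / (1 - s) ^ Suc m * ((1 - s ^ Suc n) / (1 - s))
    \<le> 1 / (1 - s) ^ Suc m * (1 / (1 - s))"
    using assms by (intro mult_left_mono divide_right_mono) auto
  finally have "real ((Suc m + n) choose n) * s ^ n \<le> 1 / (1 - s) ^ Suc m * (1 / (1 - s))" .
  then show ?case by (simp add: mult_ac)
qed

text \<open>Since \<mu> is at least 1, its Pochhammer symbol is at least \<open>fact n\<close>, and
  for integer \<open>m\<close> the remaining quotient is a binomial coefficient.\<close>

lemma pochhammer_ratio_le:
  fixes m \<mu> :: nat
  assumes "m > 0" "\<mu> > 0"
  shows "pochhammer (real m) n / pochhammer (real \<mu>) n \<le> real ((m - 1 + n) choose n)"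
    and "0 \<le> pochhammer (real m) n / pochhammer (real \<mu>) n"
proof -
  have "(fact n :: real) = pochhammer 1 n" by (simp add: pochhammer_fact)
  also have "\<dots> \<le> pochhammer (real \<mu>) n"
    unfolding pochhammer_prod using assms by (intro prod_mono) auto
  finally have "pochhammer (real m) n / pochhammer (real \<mu>) n \<le> pochhammer (real m) n / fact n"
    by (intro divide_left_mono) (auto simp: pochhammer_nonneg assms pochhammer_pos)
  also have "\<dots> = real ((m - 1 + n) choose n)"
    using assms by (simp add: binomial_gbinomial gbinomial_pochhammer' of_nat_diff)
  finally show "pochhammer (real m) n / pochhammer (real \<mu>) n \<le> real ((m - 1 + n) choose n)" .
  show "0 \<le> pochhammer (real m) n / pochhammer (real \<mu>) n" using assms
    by (simp add: pochhammer_nonneg)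
qed

text \<open>Raising the growth rate from \<open>Q\<close> to \<open>r\<close> leaves a factor
  \<open>(Q / r) ^ n\<close> that absorbs the binomial coefficient. The bound is uniform in
  \<open>q\<close> up to \<open>Q\<close>, and with \<open>r < 1\<close> it is later beaten by the
  factor \<open>exp (- y)\<close> of the density.\<close>

lemma kummer_1F1_term_le:
  fixes m \<mu> :: nat and Q r q y :: real
  assumes "m > 0" "\<mu> > 0" "0 \<le> q" "q \<le> Q" "Q < r" "0 \<le> y"
  shows "pochhammer (real m) n / pochhammer (real \<mu>) n * (q * y) ^ n / fact n
    \<le> 1 / (1 - Q / r) ^ m * ((r * y) ^ n / fact n)" (is "?L \<le> ?R")
proof -
  have "?L \<le> real ((m - 1 + n) choose n) * (q * y) ^ n / fact n"
    using pochhammer_ratio_le[OF assms(1,2), of n] assms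
    by (intro divide_right_mono mult_right_mono) auto
  also have "\<dots> \<le> real ((m - 1 + n) choose n) * (Q * y) ^ n / fact n"
    using assms by (intro divide_right_mono mult_left_mono power_mono mult_right_mono) auto
  also have "\<dots> = (real ((m - 1 + n) choose n) * (Q / r) ^ n) * ((r * y) ^ n / fact n)"
    using assms by (simp add: power_divide power_mult_distrib)
  also have "\<dots> \<le> 1 / (1 - Q / r) ^ Suc (m - 1) * ((r * y) ^ n / fact n)"
    using assms by (intro mult_right_mono choose_mult_power_le) auto
  finally show ?thesis using assms by simp
qed

lemma summable_kummer_1F1:
  fixes m \<mu> :: nat
  assumes "m > 0" "\<mu> > 0"
  shows "summable (\<lambda>n. pochhammer (real m) n / pochhammer (real \<mu>) n * w ^ n / fact n)"
proof (rule summable_comparison_test')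
  show "summable (\<lambda>n. 1 / (1 - 1 / 2) ^ m * ((2 * \<bar>w\<bar>) ^ n / fact n))"
    by (intro summable_mult) (use summable_exp[of "2 * \<bar>w\<bar>"]
      in \<open>simp add: divide_inverse mult.commute\<close>)
  show "norm (pochhammer (real m) n / pochhammer (real \<mu>) n * w ^ n / fact n)
     \<le> 1 / (1 - 1 / 2) ^ m * ((2 * \<bar>w\<bar>) ^ n / fact n)" for n
    \<comment> \<open>With \<open>q = Q = 1\<close> and \<open>r = 2\<close> the quotient
      \<open>Q / r\<close> is the \<open>1 / 2\<close> of the majorant.\<close>
    using kummer_1F1_term_le[OF assms, of 1 1 2 "\<bar>w\<bar>" n] assms
    by (simp add: abs_mult power_abs pochhammer_nonneg)
qed

lemma kummer_1F1_le:
  fixes m \<mu> :: nat and Q r q y :: real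
  assumes "m > 0" "\<mu> > 0" "0 \<le> q" "q \<le> Q" "Q < r" "0 \<le> y"
  shows "kummer_1F1 (real m) (real \<mu>) (q * y) \<le> 1 / (1 - Q / r) ^ m * exp (r * y)"
proof -
  have s: "(\<lambda>n. 1 / (1 - Q / r) ^ m * ((r * y) ^ n / fact n)) sums (1 / (1 - Q / r) ^ m * exp (r
    * y))"
    by (intro sums_mult) (use exp_converges[of "r * y"] in \<open>simp add: divide_inverse mult.commute\<close>)
  show "kummer_1F1 (real m) (real \<mu>) (q * y) \<le> 1 / (1 - Q / r) ^ m * exp (r * y)"
    unfolding kummer_1F1_def
    by (rule suminf_le[OF _ summable_kummer_1F1 sums_summable[OF s], THEN order_trans])
       (use assms kummer_1F1_term_le[OF assms] sums_unique[OF s] in auto)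
qed

lemma kummer_1F1_nonneg:
  fixes m \<mu> :: nat
  assumes "m > 0" "\<mu> > 0" "0 \<le> w"
  shows "0 \<le> kummer_1F1 (real m) (real \<mu>) w"
  using assms unfolding kummer_1F1_def
  by (intro suminf_nonneg summable_kummer_1F1)
     (auto intro!: divide_nonneg_nonneg mult_nonneg_nonneg pochhammer_nonneg)

lemma isCont_kummer_1F1:
  fixes m \<mu> :: nat
  assumes "m > 0" "\<mu> > 0"
  shows "isCont (kummer_1F1 (real m) (real \<mu>)) w"
proof -
  have "isCont (\<lambda>w. \<Sum>n. (pochhammer (real m) n / pochhammer (real \<mu>) n / fact n) * w ^ n) w"
    by (rule isCont_powser_converges_everywhere)
       (use summable_kummer_1F1[OF assms] in \<open>simp add: field_simps\<close>)
  then show ?thesis by (simp add: kummer_1F1_def[abs_def] field_simps)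
qed

lemma kummer_1F1_measurable:
  fixes m \<mu> :: nat
  assumes "m > 0" "\<mu> > 0"
  shows "kummer_1F1 (real m) (real \<mu>) \<in> borel_measurable borel"
  using isCont_kummer_1F1[OF assms]
  by (intro borel_measurable_continuous_onI continuous_at_imp_continuous_on) auto

subsection \<open>The density as a mixture of Erlang densities\<close>

text \<open>The relation \<open>A * B = A + B\<close> lowers one exponent of a mixed monomial at a
  time until only pure powers remain, and the coefficients follow Pascal's rule. No division occurs,
  so the identity holds for formal power series.\<close>

lemma power_mult_power_partial_fractions:
  fixes A B :: "'a :: comm_ring_1"
  assumes AB: "A * B = A + B" and "n + m > 0"
  shows "A ^ n * B ^ m = (\<Sum>l<n. of_nat ((m + l - 1) choose l) * A ^ (n - l))
     + (\<Sum>l<m. of_nat ((n + l - 1) choose l) * B ^ (m - l))"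
  using \<open>n + m > 0\<close>
proof (induction "n + m" arbitrary: n m rule: less_induct)
  case less
  \<comment> \<open>Truncated subtraction makes the coefficient 1 at \<open>l = 0\<close>; for
    larger \<open>l\<close> it is \<open>(l - 1) choose l\<close>, which vanishes.\<close>
  have zero: "(\<Sum>l<k. of_nat ((0 + l - 1) choose l) * C ^ (k - l)) = C ^ k" if "k > 0"
    for k and C :: 'a
  proof -
    have "(\<Sum>l<k. of_nat ((0 + l - 1) choose l) * C ^ (k - l)) = (\<Sum>l<k. if l = 0 then C ^ k else 0)"
      by (intro sum.cong) (auto simp: binomial_eq_0)
    then show ?thesis using that by simp
  qed
  \<comment> \<open>Pascal's rule, applied after the term \<open>l = 0\<close> has been split
    off.\<close>
  have step: "(\<Sum>l<Suc n. of_nat ((Suc m + l - 1) choose l) * C ^ (Suc n - l)) =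
     (\<Sum>l<Suc n. of_nat ((m + l - 1) choose l) * C ^ (Suc n - l)) +
     (\<Sum>l<n. of_nat ((Suc m + l - 1) choose l) * C ^ (n - l))" for n m and C :: 'a
  proof -
    have "(\<Sum>l<Suc n. of_nat ((Suc m + l - 1) choose l) * C ^ (Suc n - l)) =
      C ^ Suc n + (\<Sum>l<n. of_nat ((Suc m + l) choose Suc l) * C ^ (n - l))"
      by (subst sum.lessThan_Suc_shift) simp
    also have "\<dots> = C ^ Suc n + (\<Sum>l<n. of_nat ((m + l) choose Suc l) * C ^ (n - l)) +
       (\<Sum>l<n. of_nat ((m + l) choose l) * C ^ (n - l))"
      by (simp add: sum.distrib[symmetric] algebra_simps)
    also have "C ^ Suc n + (\<Sum>l<n. of_nat ((m + l) choose Suc l) * C ^ (n - l))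
      = (\<Sum>l<Suc n. of_nat ((m + l - 1) choose l) * C ^ (Suc n - l))"
      by (subst sum.lessThan_Suc_shift) simp
    finally show ?thesis by simp
  qed
  consider "n = 0" | "m = 0" | n' m' :: nat where "n = Suc n'" "m = Suc m'"
    by (cases n; cases m) auto
  then show ?case
  proof cases
    case 1
    then show ?thesis using less.prems zero[of m B] by simp
  next
    case 2
    then show ?thesis using less.prems zero[of n A] by simp
  next
    case 3
    have "A ^ n * B ^ m = A ^ n' * B ^ m' * (A * B)"
      using 3 by (simp add: algebra_simps)
    also have "\<dots> = A ^ Suc n' * B ^ m' + A ^ n' * B ^ Suc m'"
      unfolding AB by (simp add: algebra_simps)
    also have "\<dots> = (\<Sum>l<n. of_nat ((m + l - 1) choose l) * A ^ (n - l))
     + (\<Sum>l<m. of_nat ((n + l - 1) choose l) * B ^ (m - l))"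
      using less.hyps[of "Suc n'" m'] less.hyps[of n' "Suc m'"] step[where m = m' and n = n' and C
        = A] step[where m = n' and n = m' and C = B] 3
      by (simp add: add_ac)
    finally show ?thesis .
  qed
qed

text \<open>A power series \<open>F\<close> with zero constant term encodes the function
  \<open>\<Sum>n. F $ Suc n * y ^ n / fact n\<close>, so that the unit-scale Erlang density of shape \<open>k\<close> is
  \<open>exp (- y)\<close> times the function encoded by \<open>fps_X ^ k\<close>.\<close>
definition encodes :: "real fps \<Rightarrow> real \<Rightarrow> real \<Rightarrow> bool" where
  "encodes F y s \<longleftrightarrow> (\<lambda>n. fps_nth F (Suc n) * (y ^ n / fact n)) sums s"

lemma encodes_unique: "encodes F y s \<Longrightarrow> encodes F y t \<Longrightarrow> s = t"
  by (auto simp: encodes_def intro: sums_unique2)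

lemma encodes_cmult: "encodes F y s \<Longrightarrow> encodes (fps_const c * F) y (c * s)"
  unfolding encodes_def by (simp add: mult.assoc sums_mult del: times_divide_eq_right)

lemma encodes_sum:
  assumes "\<And>i. i \<in> I \<Longrightarrow> encodes (F i) y (s i)"
  shows "encodes (\<Sum>i\<in>I. F i) y (\<Sum>i\<in>I. s i)"
  unfolding encodes_def fps_sum_nth sum_distrib_right
  using assms unfolding encodes_def by (intro sums_sum)

lemma encodes_X_power: "encodes (fps_X ^ Suc j) y (y ^ j / fact j)"
proof -
  have "(\<lambda>n. fps_nth (fps_X ^ Suc j) (Suc n) * (y ^ n / fact n)) = (\<lambda>n.
    if n = j then y ^ j / fact j else 0)"
    by (auto simp: fps_X_power_nth fun_eq_iff simp del: power_Suc)
  then show ?thesis unfolding encodes_def using sums_single[of j "\<lambda>_. y ^ j / fact j"] by simp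
qed

text \<open>The coefficients of the negative binomial power are
  \<open>pochhammer m n / fact n * q ^ n\<close>. Multiplying by \<open>fps_X ^ \<mu>\<close> moves
  them, and the factorial at the new position splits into \<open>fact (\<mu> - 1)\<close> times the
  denominator Pochhammer symbol.\<close>

lemma encodes_kummer_1F1:
  fixes m \<mu> :: nat
  assumes "m > 0" "\<mu> > 0"
  shows "encodes (fps_X ^ \<mu> * inverse (1 - fps_const q * fps_X) ^ m) y
     (y ^ (\<mu> - 1) / fact (\<mu> - 1) * kummer_1F1 (real m) (real \<mu>) (q * y))"
proof -
  define F where "F = inverse (1 - fps_const q * fps_X) ^ m"
  have F: "fps_nth F n = real ((m + n - 1) choose n) * q ^ n" for n
    unfolding F_def fps_inverse_power[symmetric] one_minus_const_fps_X_neg_power'[OF assms(1)]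
      by simp
  let ?f = "\<lambda>n. fps_nth (fps_X ^ \<mu> * F) (Suc n) * (y ^ n / fact n)"
  \<comment> \<open>The shift is by \<open>\<mu> - 1\<close> rather than \<mu> because
    \<open>encodes\<close> starts at the coefficient of index 1.\<close>
  have shift: "?f (n + (\<mu> - 1)) = y ^ (\<mu> - 1) / fact (\<mu> - 1) *
     (pochhammer (real m) n / pochhammer (real \<mu>) n * (q * y) ^ n / fact n)" for n
  proof -
    have 1: "fps_nth (fps_X ^ \<mu> * F) (Suc (n + (\<mu> - 1))) = pochhammer (real m) n / fact n * q ^ n"
      using assms by (simp add: fps_X_power_mult_nth F binomial_gbinomial gbinomial_pochhammer'
        of_nat_diff)
    have "fact (\<mu> - 1) * pochhammer (real \<mu>) n
      = pochhammer 1 (\<mu> - 1) * pochhammer (1 + real (\<mu> - 1)) n"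
      using assms by (simp add: pochhammer_fact of_nat_diff)
    also have "\<dots> = pochhammer (1::real) (\<mu> - 1 + n)" by (simp add: pochhammer_product' )
    also have "\<dots> = fact (n + (\<mu> - 1))" by (simp add: pochhammer_fact[symmetric] add.commute)
    finally have 2: "(fact (n + (\<mu> - 1)) :: real) = fact (\<mu> - 1) * pochhammer (real \<mu>) n" ..
    show ?thesis unfolding 1 2 by (simp add: power_add power_mult_distrib mult_ac)
  qed
  have "(\<lambda>n. ?f (n + (\<mu> - 1))) sums (y ^ (\<mu> - 1) / fact (\<mu> - 1) * kummer_1F1 (real m) (real \<mu>) (q
    * y))"
    unfolding shift kummer_1F1_def
    by (intro sums_mult summable_sums summable_kummer_1F1 assms)
  moreover have "?f n = 0" if "n < \<mu> - 1" for n
    using that by (simp add: fps_X_power_mult_nth)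
  ultimately show ?thesis
    unfolding encodes_def F_def[symmetric] by (subst (asm) sums_zero_iff_shift) auto
qed

text \<open>The Pochhammer symbols cancel. Through \<open>encodes_kummer_1F1\<close> with equal
  parameters, powers of \<open>fps_X * J\<close> thus encode a monomial times an exponential, which
  changes the Erlang rate.\<close>

lemma kummer_1F1_same:
  fixes \<mu> :: nat
  assumes "\<mu> > 0"
  shows "kummer_1F1 (real \<mu>) (real \<mu>) w = exp w"
proof -
  have "pochhammer (real \<mu>) n \<noteq> 0" for n
    using pochhammer_pos[of "real \<mu>" n] assms by simp
  then show ?thesis by (simp add: kummer_1F1_def exp_def divide_inverse mult.commute)
qed

text \<open>With \<open>V = p X J\<close>, the defining equation of \<open>J\<close> gives
  \<open>p J = p + q V\<close>, and the binomial theorem settles \<mu> \<le> \<open>m\<close>.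
  Otherwise \<open>X ^ n * V ^ m\<close> must be split into pure powers, which is the partial
  fraction identity after rescaling.\<close>

lemma mix_fps_expansion:
  fixes \<mu> m :: nat
  assumes "\<mu> > 0" "m > 0" and dom: "\<kappa> \<in> mix_dom \<mu> m"
  defines "p \<equiv> mix_p \<kappa> \<mu> m" and "q \<equiv> mix_q \<kappa> \<mu> m"
  defines "J \<equiv> inverse (1 - fps_const q * fps_X)"
  shows "fps_const (p ^ m) * (fps_X ^ \<mu> * J ^ m) =
     (\<Sum>i=0..mix_M \<mu> m. fps_const (mix_C \<kappa> \<mu> m i) *
        (if \<mu> > m \<and> i \<le> \<mu> - m then fps_X else fps_const p * fps_X * J) ^ mix_m \<mu> m i)"
proof -
  define X :: "real fps" where "X = fps_X"
  define V where "V = fps_const p * X * J"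
  have J: "J * (1 - fps_const q * X) = 1"
    unfolding J_def X_def by (rule inverse_mult_eq_1) simp
  then have J': "J = 1 + fps_const q * X * J" by (simp add: algebra_simps)
  have V_pow: "V ^ k = fps_const (p ^ k) * (X ^ k * J ^ k)" for k
    by (simp add: V_def power_mult_distrib mult.assoc fps_const_power)
  have "\<kappa> \<ge> 0" using dom by (simp add: mix_dom_def)
  then have den: "real \<mu> * \<kappa> + real m > 0" using assms by (simp add: add_nonneg_pos)
  have p: "p > 0" using den assms by (simp add: p_def mix_p_def)
  show ?thesis unfolding X_def[symmetric] V_def[symmetric]
  proof (cases "\<mu> > m")
    case False
    define d where "d = m - \<mu>"
    have m: "m = \<mu> + d" using False by (simp add: d_def)
    have "fps_const p * J = fps_const p * (1 + fps_const q * X * J)" using J' by simp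
    also have "\<dots> = fps_const p + fps_const q * V" by (simp add: V_def algebra_simps)
    finally have pJ: "fps_const p * J = fps_const p + fps_const q * V" .
    have "fps_const (p ^ m) * (X ^ \<mu> * J ^ m) = V ^ \<mu> * (fps_const p * J) ^ d"
      by (simp add: V_pow m power_add power_mult_distrib fps_const_power mult_ac flip:
        fps_const_mult)
    also have "\<dots> = V ^ \<mu> * (\<Sum>i\<le>d. of_nat (d choose i) * fps_const p ^ i * (fps_const q * V) ^ (d
      - i))"
      unfolding pJ by (subst binomial_ring) simp
    also have "\<dots> = (\<Sum>i\<le>d. fps_const (real (d choose i) * p ^ i * q ^ (d - i)) * V ^ (m - i))"
      unfolding sum_distrib_left
    proof (intro sum.cong refl)
      fix i assume "i \<in> {..d}"
      then have "m - i = \<mu> + (d - i)" by (simp add: m)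
      then show "V ^ \<mu> * (of_nat (d choose i) * fps_const p ^ i * (fps_const q * V) ^ (d - i)) =
        fps_const (real (d choose i) * p ^ i * q ^ (d - i)) * V ^ (m - i)"
        by (simp add: power_add power_mult_distrib fps_of_nat mult_ac fps_const_power flip:
          fps_const_mult)
    qed
    also have "\<dots> = (\<Sum>i=0..mix_M \<mu> m. fps_const (mix_C \<kappa> \<mu> m i) *
        (if \<mu> > m \<and> i \<le> \<mu> - m then X else V) ^ mix_m \<mu> m i)"
      using False by (simp add: mix_M_def mix_C_def mix_m_def d_def p_def q_def atLeast0AtMost)
    finally show "fps_const (p ^ m) * (X ^ \<mu> * J ^ m) =
      (\<Sum>i=0..mix_M \<mu> m. fps_const (mix_C \<kappa> \<mu> m i) *
        (if \<mu> > m \<and> i \<le> \<mu> - m then X else V) ^ mix_m \<mu> m i)" .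
  next
    case True
    define n where "n = \<mu> - m"
    have n: "n > 0" and \<mu>: "\<mu> = n + m" using True by (auto simp: n_def)
    \<comment> \<open>Here \<open>mix_dom\<close> matters: the weights of this case divide by powers
      of \<open>q\<close>.\<close>
    have "\<kappa> > 0" using dom True by (simp add: mix_dom_def)
    then have q: "q > 0" using den assms by (simp add: q_def mix_q_def)
    \<comment> \<open>Formally \<open>1 / A + 1 / B = 1\<close>, because \<open>1 / B\<close> is
      \<open>- (1 - q X) / (q X)\<close>. Powers of \<open>A\<close> lead to scale
      \<open>mix_Delta1\<close>, powers of \<open>B\<close> to \<open>mix_Delta2\<close>.\<close>
    define A where "A = fps_const q * X"
    define B where "B = - (A * J)"
    have "A * B = A + B"
    proof -
      have "A * B = - A * (A * J)" by (simp add: B_def)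
      also have "A * J = J - 1" using J' by (simp add: A_def algebra_simps)
      finally show ?thesis by (simp add: B_def algebra_simps)
    qed
    note pf = power_mult_power_partial_fractions[OF this, of n m]
    have A: "A ^ k = fps_const (q ^ k) * X ^ k" for k
      by (simp add: A_def power_mult_distrib fps_const_power)
    have "B = fps_const (- q / p) * V"
      using p by (simp add: B_def A_def V_def mult.assoc[symmetric] flip: fps_const_neg)
    then have B: "B ^ k = fps_const ((- q / p) ^ k) * V ^ k" for k
      by (simp add: power_mult_distrib fps_const_power)
    \<comment> \<open>The constant undoes the rescaling, so that \<open>c * A ^ n * B ^ m\<close> is
      \<open>X ^ n * V ^ m\<close>.\<close>
    define c where "c = (- p / q) ^ m / q ^ n"
    have "fps_const (p ^ m) * (X ^ \<mu> * J ^ m) = X ^ n * V ^ m"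
      by (simp add: V_pow \<mu> power_add mult_ac)
    also have "\<dots> = fps_const (c * q ^ n * (- q / p) ^ m) * (X ^ n * V ^ m)"
      using p q by (simp add: c_def flip: power_mult_distrib)
    also have "\<dots> = fps_const c * (A ^ n * B ^ m)"
      by (simp add: A B mult_ac flip: fps_const_mult)
    also have "\<dots> = (\<Sum>l<n. fps_const (c * real ((m + l - 1) choose l) * q ^ (n - l)) * X ^ (n - l))
     + (\<Sum>l<m. fps_const (c * real ((n + l - 1) choose l) * (- q / p) ^ (m - l)) * V ^ (m - l))"
      using n unfolding pf[OF add_pos_nonneg[OF n le0]] unfolding A B
      by (simp add: distrib_left sum_distrib_left fps_of_nat mult_ac flip: fps_const_mult)
    also have "(\<Sum>l<n. fps_const (c * real ((m + l - 1) choose l) * q ^ (n - l)) * X ^ (n - l)) =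
       (\<Sum>l<n. fps_const (mix_C \<kappa> \<mu> m (Suc l)) * X ^ mix_m \<mu> m (Suc l))"
    proof (intro sum.cong refl)
      fix l assume l: "l \<in> {..<n}"
      have "q powi (- int m - int (Suc l) + 1) = inverse (q ^ (m + l))"
      proof -
        have "- int m - int (Suc l) + 1 = - int (m + l)" by simp
        then show ?thesis by (simp only: power_int_minus power_int_of_nat)
      qed
      moreover have "c * q ^ (n - l) = (- 1) ^ m * p ^ m * inverse (q ^ (m + l))"
      proof -
        have "(- p / q) ^ m = (- 1) ^ m * p ^ m / q ^ m"
          by (simp add: power_minus[of "p / q"] power_divide)
        then show ?thesis using l q by (simp add: c_def power_diff power_add field_simps)
      qed
      ultimately have "mix_C \<kappa> \<mu> m (Suc l) = c * real ((m + l - 1) choose l) * q ^ (n - l)"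
        using l True by (simp add: mix_C_def p_def[symmetric] q_def[symmetric] Let_def n_def
          mult_ac)
      moreover have "mix_m \<mu> m (Suc l) = n - l"
        using l True by (simp add: mix_m_def n_def)
      ultimately show "fps_const (c * real ((m + l - 1) choose l) * q ^ (n - l)) * X ^ (n - l) =
        fps_const (mix_C \<kappa> \<mu> m (Suc l)) * X ^ mix_m \<mu> m (Suc l)"
        by simp
    qed
    also have "(\<Sum>l<m. fps_const (c * real ((n + l - 1) choose l) * (- q / p) ^ (m - l)) * V ^ (m
      - l)) =
       (\<Sum>l<m. fps_const (mix_C \<kappa> \<mu> m (n + Suc l)) * V ^ mix_m \<mu> m (n + Suc l))"
    proof (intro sum.cong refl)
      fix l assume l: "l \<in> {..<m}"
      have "q powi (- int (n + Suc l) + 1) = inverse (q ^ (n + l))"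
      proof -
        have "- int (n + Suc l) + 1 = - int (n + l)" by simp
        then show ?thesis by (simp only: power_int_minus power_int_of_nat)
      qed
      moreover have "c * (- q / p) ^ (m - l) = (- 1) ^ l * p ^ l * inverse (q ^ (n + l))"
      proof -
        have "c * (- q / p) ^ (m - l) = (- p / q) ^ l * ((- p / q) ^ (m - l) * (- q / p) ^ (m - l))
          / q ^ n"
          using l by (simp add: c_def flip: power_add)
        also have "(- p / q) ^ (m - l) * (- q / p) ^ (m - l) = 1"
          using p q by (simp flip: power_mult_distrib)
        finally show ?thesis
          by (simp add: power_divide power_minus[of "p / q"] power_add field_simps)
      qed
      \<comment> \<open>Term \<open>l\<close> of the second block is mixture index
        \<open>i = n + l + 1\<close>; these are the truncated differences occurring in
        \<open>mix_C\<close>.\<close>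
      moreover have "n + Suc l + m - \<mu> - 1 = l" "n + Suc l - 2 = n + l - 1" by (auto simp: \<mu>)
      ultimately have "mix_C \<kappa> \<mu> m (n + Suc l)
        = c * real ((n + l - 1) choose l) * (- q / p) ^ (m - l)"
        using True by (simp add: mix_C_def p_def[symmetric] q_def[symmetric] Let_def
          n_def[symmetric] mult_ac)
      moreover have "mix_m \<mu> m (n + Suc l) = m - l"
        using l n by (auto simp: mix_m_def \<mu>)
      ultimately show "fps_const (c * real ((n + l - 1) choose l) * (- q / p) ^ (m - l)) * V ^ (m
        - l) =
        fps_const (mix_C \<kappa> \<mu> m (n + Suc l)) * V ^ mix_m \<mu> m (n + Suc l)"
        by simp
    qed
    also have "(\<Sum>l<n. fps_const (mix_C \<kappa> \<mu> m (Suc l)) * X ^ mix_m \<mu> m (Suc l)) +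
       (\<Sum>l<m. fps_const (mix_C \<kappa> \<mu> m (n + Suc l)) * V ^ mix_m \<mu> m (n + Suc l)) =
       (\<Sum>i=0..mix_M \<mu> m. fps_const (mix_C \<kappa> \<mu> m i) *
        (if \<mu> > m \<and> i \<le> \<mu> - m then X else V) ^ mix_m \<mu> m i)" (is "_ = (\<Sum>i=0..mix_M \<mu> m. ?f i)")
    \<comment> \<open>Index 0 has weight 0, and the remaining indices split at \<open>n\<close> into
      the two blocks.\<close>
    proof -
      have "(\<Sum>i=0..mix_M \<mu> m. ?f i) = ?f 0 + (\<Sum>i=1..n+m. ?f i)"
        using True by (simp add: mix_M_def \<mu> sum.atLeast_Suc_atMost)
      also have "?f 0 = 0" using True by (simp add: mix_C_def)
      also have "(\<Sum>i=1..n+m. ?f i) = (\<Sum>i=1..n. ?f i) + (\<Sum>i=n+1..n+m. ?f i)"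
        by (rule sum.ub_add_nat) simp
      also have "(\<Sum>i=1..n. ?f i) = (\<Sum>l<n. ?f (Suc l))"
        by (rule sum.atLeast1_atMost_eq[unfolded One_nat_def[symmetric]])
      also have "(\<Sum>i=n+1..n+m. ?f i) = (\<Sum>i=1..m. ?f (n + i))"
        using sum.shift_bounds_cl_nat_ivl[of ?f 1 n m] by (simp add: add.commute)
      also have "\<dots> = (\<Sum>l<m. ?f (n + Suc l))"
        by (rule sum.atLeast1_atMost_eq[unfolded One_nat_def[symmetric]])
      finally show ?thesis using True by (simp add: n_def[symmetric])
    qed
    finally show "fps_const (p ^ m) * (X ^ \<mu> * J ^ m) =
      (\<Sum>i=0..mix_M \<mu> m. fps_const (mix_C \<kappa> \<mu> m i) *
        (if \<mu> > m \<and> i \<le> \<mu> - m then X else V) ^ mix_m \<mu> m i)" .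
  qed
qed

text \<open>For integer \<mu> and \<open>m\<close> the real powers become ordinary ones, and the
  constants combine into \<open>mix_p\<close>, \<open>mix_q\<close> and the rate \<open>a\<close>,
  the reciprocal of \<open>mix_Delta1\<close>.\<close>

lemma kms_density_eq:
  fixes \<mu> m :: nat
  assumes "\<mu> > 0" "m > 0" "\<kappa> \<ge> 0" "g > 0" "x > 0"
  defines "a \<equiv> real \<mu> * (1 + \<kappa>) / g"
  shows "kms_density g \<kappa> (real \<mu>) (real m) x =
    mix_p \<kappa> \<mu> m ^ m * a ^ \<mu> / fact (\<mu> - 1) * x ^ (\<mu> - 1) * exp (- (a * x))
      * kummer_1F1 (real m) (real \<mu>) (mix_q \<kappa> \<mu> m * (a * x))"
proof -
  have den: "real \<mu> * \<kappa> + real m > 0" using assms by (simp add: add_nonneg_pos)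
  have G: "Gamma (real \<mu>) = fact (\<mu> - 1)"
    using assms Gamma_fact[of "\<mu> - 1", where 'a = real] by (simp add: of_nat_diff)
  have *: "(x / g) powr (real \<mu> - 1) = x ^ (\<mu> - 1) / g ^ (\<mu> - 1)"
    using assms powr_realpow[of "x / g" "\<mu> - 1"] by (simp add: of_nat_diff power_divide)
  have "real \<mu> powr real \<mu> * real m powr real m * (1 + \<kappa>) powr real \<mu> / (Gamma (real \<mu>) * g
    * (real \<mu> * \<kappa> + real m) powr real m)
        * (x / g) powr (real \<mu> - 1) = mix_p \<kappa> \<mu> m ^ m * a ^ \<mu> / fact (\<mu> - 1) * x ^ (\<mu> - 1)"
  proof -
    have "a ^ \<mu> = real \<mu> ^ \<mu> * (1 + \<kappa>) ^ \<mu> / (g * g ^ (\<mu> - 1))"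
      using assms by (simp add: power_divide power_mult_distrib flip: power_Suc)
    then show ?thesis
      unfolding G * mix_p_def power_divide using assms(1-5) den
      by (simp add: powr_realpow) (simp (no_asm) add: mult_ac)
  qed
  moreover have "(real \<mu>)\<^sup>2 * \<kappa> * (1 + \<kappa>) / (real \<mu> * \<kappa> + real m) * (x / g) = mix_q \<kappa> \<mu> m * (a * x)"
    by (simp add: mix_q_def a_def power2_eq_square)
  moreover have "real \<mu> * (1 + \<kappa>) * x / g = a * x" by (simp add: a_def)
  ultimately show ?thesis
    using \<open>x > 0\<close> unfolding kms_density_def by (simp only: if_True)
qed

lemma mix_m_pos: "\<mu> > 0 \<Longrightarrow> i \<le> mix_M \<mu> m \<Longrightarrow> mix_m \<mu> m i > 0"
  by (auto simp: mix_m_def mix_M_def split: if_splits)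

lemma mix_Omega_pos:
  assumes "g > 0" "\<kappa> \<ge> 0" "\<mu> > 0" "m > 0"
  shows "mix_Omega g \<kappa> \<mu> m i > 0"
proof -
  have "real \<mu> * \<kappa> + real m > 0" "1 + \<kappa> > 0" using assms by (simp_all add: add_nonneg_pos)
  then show ?thesis using assms by (simp add: mix_Omega_def mix_Delta1_def mix_Delta2_def)
qed

text \<open>Both sides of \<open>mix_fps_expansion\<close> are evaluated through
  \<open>encodes\<close>; uniqueness of sums equates the values, and the factor
  \<open>a * exp (- y)\<close> turns each value into an Erlang density.\<close>

lemma kms_density_eq_mixture:
  fixes \<mu> m :: nat
  assumes "\<mu> > 0" "m > 0" and dom: "\<kappa> \<in> mix_dom \<mu> m" and "g > 0" "x > 0"
  shows "kms_density g \<kappa> (real \<mu>) (real m) x =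
    (\<Sum>i=0..mix_M \<mu> m. mix_C \<kappa> \<mu> m i * erlang_density (mix_m \<mu> m i - 1) (1 / mix_Omega g \<kappa> \<mu> m i) x)"
proof -
  define p q where "p = mix_p \<kappa> \<mu> m" and "q = mix_q \<kappa> \<mu> m"
  define J where "J = inverse (1 - fps_const q * fps_X)"
  define a where "a = real \<mu> * (1 + \<kappa>) / g"
  define y where "y = a * x"
  have \<kappa>: "\<kappa> \<ge> 0" using dom by (simp add: mix_dom_def)
  have den: "real \<mu> * \<kappa> + real m > 0" using assms \<kappa> by (simp add: add_nonneg_pos)
  have pq: "q = 1 - p" using den by (simp add: p_def q_def mix_p_def mix_q_def field_simps)
  define s where "s = (\<lambda>i. if \<mu> > m \<and> i \<le> \<mu> - m then y ^ (mix_m \<mu> m i - 1) / fact (mix_m \<mu> m i - 1)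
     else p ^ mix_m \<mu> m i * (y ^ (mix_m \<mu> m i - 1) / fact (mix_m \<mu> m i - 1) * exp (q * y)))"
  have X: "encodes (fps_X ^ k) y (y ^ (k - 1) / fact (k - 1))" if "k > 0" for k
    using encodes_X_power[of "k - 1" y] that by simp
  have V: "encodes ((fps_const p * fps_X * J) ^ k) y (p ^ k * (y ^ (k - 1) / fact (k - 1) * exp (q
    * y)))" if "k > 0" for k
    using encodes_cmult[OF encodes_kummer_1F1[OF that that, of q y], of
      "p ^ k"] kummer_1F1_same[OF that, of "q * y"]
    by (simp add: J_def power_mult_distrib fps_const_power mult.assoc)
  have "encodes (\<Sum>i=0..mix_M \<mu> m. fps_const (mix_C \<kappa> \<mu> m i) *
        (if \<mu> > m \<and> i \<le> \<mu> - m then fps_X else fps_const p * fps_X * J) ^ mix_m \<mu> m i) y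
     (\<Sum>i=0..mix_M \<mu> m. mix_C \<kappa> \<mu> m i * s i)"
    by (intro encodes_sum encodes_cmult) (use X V mix_m_pos[OF assms(1)] in \<open>auto simp: s_def\<close>)
  moreover have "encodes (fps_const (p ^ m) * (fps_X ^ \<mu> * J ^ m)) y
     (p ^ m * (y ^ (\<mu> - 1) / fact (\<mu> - 1) * kummer_1F1 (real m) (real \<mu>) (q * y)))"
    unfolding J_def by (intro encodes_cmult encodes_kummer_1F1 assms)
  ultimately have eq: "p ^ m * (y ^ (\<mu> - 1) / fact (\<mu> - 1) * kummer_1F1 (real m) (real \<mu>) (q * y))
     = (\<Sum>i=0..mix_M \<mu> m. mix_C \<kappa> \<mu> m i * s i)"
    using mix_fps_expansion[OF assms(1,2) dom] encodes_unique
    unfolding p_def[symmetric] q_def[symmetric] J_def[symmetric] by metis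
  have s: "a * exp (- y) * s i = erlang_density (mix_m \<mu> m i - 1) (1 / mix_Omega g \<kappa> \<mu> m i) x"
    if i: "i \<le> mix_M \<mu> m" for i
  proof -
    obtain k where k: "mix_m \<mu> m i = Suc k" using mix_m_pos[OF assms(1) i] gr0_implies_Suc by blast
    have D1: "1 / mix_Delta1 g \<kappa> \<mu> = a" by (simp add: mix_Delta1_def a_def)
    have D2: "1 / mix_Delta2 g \<kappa> \<mu> m = p * a" by (simp add: mix_Delta2_def a_def p_def mix_p_def)
    have rate: "1 / mix_Omega g \<kappa> \<mu> m i = (if \<mu> > m \<and> i \<le> \<mu> - m then a else p * a)"
      by (simp add: mix_Omega_def D1 D2)
    \<comment> \<open>Since \<open>q = 1 - p\<close>, the exponential growth of \<open>V\<close>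
      lowers the rate from \<open>a\<close> to \<open>p * a\<close>, the reciprocal of
      \<open>mix_Delta2\<close>.\<close>
    have "exp (- y) * exp (q * y) = exp (- (p * a * x))"
      unfolding exp_add[symmetric] by (simp add: y_def pq algebra_simps)
    then show ?thesis using \<open>x > 0\<close> unfolding rate
      by (simp add: s_def k erlang_density_def y_def power_mult_distrib mult_ac)
  qed
  have "kms_density g \<kappa> (real \<mu>) (real m) x =
     a * exp (- y) * (p ^ m * (y ^ (\<mu> - 1) / fact (\<mu> - 1) * kummer_1F1 (real m) (real \<mu>) (q * y)))"
  proof -
    have "a ^ \<mu> = a * a ^ (\<mu> - 1)" using assms(1) by (cases \<mu>) auto
    then show ?thesis
      using kms_density_eq[OF assms(1,2) \<kappa> assms(4,5)]
      unfolding a_def[symmetric] p_def[symmetric] q_def[symmetric] y_def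
      by (simp add: power_mult_distrib)
  qed
  also have "\<dots> = (\<Sum>i=0..mix_M \<mu> m. mix_C \<kappa> \<mu> m i * (a * exp (- y) * s i))"
    unfolding eq by (simp add: sum_distrib_left mult_ac)
  also have "\<dots> = (\<Sum>i=0..mix_M \<mu> m. mix_C \<kappa> \<mu> m i * erlang_density (mix_m \<mu> m i - 1) (1
    / mix_Omega g \<kappa> \<mu> m i) x)"
    by (intro sum.cong refl) (simp add: s)
  finally show ?thesis .
qed

subsection \<open>Dependence on the shape parameter\<close>

text \<open>A bound on \<kappa> keeps \<open>mix_q\<close> away from 1, which makes a uniform
  exponential tail possible.\<close>

lemma mix_q_le:
  assumes "0 \<le> \<kappa>" "\<kappa> \<le> K" "m > 0"
  shows "0 \<le> mix_q \<kappa> \<mu> m" "mix_q \<kappa> \<mu> m \<le> mix_q K \<mu> m" "mix_q K \<mu> m < 1"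
proof -
  have "real \<mu> * \<kappa> + real m > 0" "real \<mu> * K + real m > 0" using assms
    by (simp_all add: add_nonneg_pos)
  moreover have "real \<mu> * \<kappa> \<le> real \<mu> * K" using assms by (simp add: mult_left_mono)
  moreover have "real \<mu> * \<kappa> * real m \<le> real \<mu> * K * real m" using assms
    by (intro mult_right_mono mult_left_mono) auto
  ultimately show "0 \<le> mix_q \<kappa> \<mu> m" "mix_q \<kappa> \<mu> m \<le> mix_q K \<mu> m" "mix_q K \<mu> m < 1"
    using assms by (simp_all add: mix_q_def divide_simps) (simp add: algebra_simps)
qed

lemma kms_density_nonneg:
  fixes \<mu> m :: nat
  assumes "\<mu> > 0" "m > 0" "\<kappa> \<ge> 0" "g > 0"
  shows "kms_density g \<kappa> (real \<mu>) (real m) x \<ge> 0"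
proof (cases "x > 0")
  case True
  then show ?thesis
    using assms mix_q_le(1)[of \<kappa> \<kappa> m \<mu>]
    by (subst kms_density_eq)
       (auto simp: mix_p_def intro!: mult_nonneg_nonneg divide_nonneg_nonneg kummer_1F1_nonneg)
qed (simp add: kms_density_def)

text \<open>Kummer's function grows at most like \<open>exp (r * a * x)\<close> with a fixed
  \<open>r < 1\<close>, so at least the share \<open>1 - r\<close> of the exponential decay survives
  uniformly in \<kappa>.\<close>

lemma kms_density_dominated:
  fixes \<mu> m :: nat
  assumes "\<mu> > 0" "m > 0" "g > 0" "K \<ge> 0"
  shows "\<exists>C l. l > 0 \<and> (\<forall>\<kappa> x. 0 \<le> \<kappa> \<longrightarrow> \<kappa> \<le> K \<longrightarrow>
    kms_density g \<kappa> (real \<mu>) (real m) x \<le> C * erlang_density (\<mu> - 1) l x)"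
proof -
  define Q where "Q = mix_q K \<mu> m"
  \<comment> \<open>The midpoint lies strictly between \<open>Q\<close> and 1: above
    \<open>Q\<close> for the bound on Kummer's function, below 1 for the decay.\<close>
  define r where "r = (1 + Q) / 2"
  have Q: "0 \<le> Q" "Q < 1" using mix_q_le[of K K m \<mu>] assms by (auto simp: Q_def)
  have r: "Q < r" "r < 1" "r > 0" using Q by (auto simp: r_def)
  \<comment> \<open>These are the extreme rates, at \<kappa> = 0 and \<kappa> = \<open>K\<close>:
    the lower one controls the decay, the upper one the prefactor.\<close>
  define a0 a1 where "a0 = real \<mu> / g" and "a1 = real \<mu> * (1 + K) / g"
  have a0: "a0 > 0" using assms by (simp add: a0_def)
  define l where "l = (1 - r) * a0"
  have l: "l > 0" using r a0 by (simp add: l_def)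
  define C where "C = a1 ^ \<mu> * (1 / (1 - Q / r) ^ m) / l ^ \<mu>"
  have "kms_density g \<kappa> (real \<mu>) (real m) x \<le> C * erlang_density (\<mu> - 1) l x"
    if \<kappa>: "0 \<le> \<kappa>" "\<kappa> \<le> K" for \<kappa> x
  proof (cases "x > 0")
    case False
    have "C \<ge> 0" using l r assms by (auto simp: C_def a1_def)
    then show ?thesis using False l by (simp add: kms_density_def)
  next
    case x: True
    define a where "a = real \<mu> * (1 + \<kappa>) / g"
    have a: "a0 \<le> a" "a \<le> a1" using \<kappa> assms by (auto simp: a_def a0_def a1_def divide_right_mono)
    have "real \<mu> * \<kappa> \<ge> 0" using \<kappa> by simp
    then have p: "0 \<le> mix_p \<kappa> \<mu> m" "mix_p \<kappa> \<mu> m \<le> 1"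
      unfolding mix_p_def using assms by (simp_all add: add_nonneg_pos)
    have nonneg: "0 \<le> kummer_1F1 (real m) (real \<mu>) (mix_q \<kappa> \<mu> m * (a * x))"
      using a a0 x mix_q_le(1)[OF \<kappa> assms(2), of \<mu>] by (intro kummer_1F1_nonneg assms) simp
    have kum: "kummer_1F1 (real m) (real \<mu>) (mix_q \<kappa> \<mu> m * (a * x))
      \<le> 1 / (1 - Q / r) ^ m * exp (r * (a * x))"
      using kummer_1F1_le[OF assms(2,1), of "mix_q \<kappa> \<mu> m" Q r "a
        * x"] mix_q_le[OF \<kappa> assms(2), of \<mu>] x a a0 r
      by (simp add: Q_def)
    have "kms_density g \<kappa> (real \<mu>) (real m) x =
      (mix_p \<kappa> \<mu> m ^ m * a ^ \<mu> / fact (\<mu> - 1) * x ^ (\<mu> - 1) * exp (- (a * x)))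
      * kummer_1F1 (real m) (real \<mu>) (mix_q \<kappa> \<mu> m * (a * x))"
      using kms_density_eq[OF assms(1,2) \<kappa>(1) assms(3) x] by (simp add: a_def)
    also have "\<dots> \<le> (1 * a1 ^ \<mu> / fact (\<mu> - 1) * x ^ (\<mu> - 1) * exp (- (a * x))) * (1 / (1 - Q
      / r) ^ m * exp (r * (a * x)))"
    proof (intro mult_mono kum nonneg divide_right_mono order_refl)
      show "mix_p \<kappa> \<mu> m ^ m \<le> 1" using p by (rule power_le_one)
      show "a ^ \<mu> \<le> a1 ^ \<mu>" using a a0 by (intro power_mono) auto
    qed (use a a0 p x in simp_all)
    also have "\<dots> = a1 ^ \<mu> / fact (\<mu> - 1) * x ^ (\<mu> - 1) * (1 / (1 - Q / r) ^ m) * exp (- ((1 - r) * a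
      * x))"
    proof -
      have "exp (- (a * x)) * exp (r * (a * x)) = exp (- ((1 - r) * a * x))"
        unfolding exp_add[symmetric] by (simp add: algebra_simps)
      then show ?thesis by simp
    qed
    also have "\<dots> \<le> a1 ^ \<mu> / fact (\<mu> - 1) * x ^ (\<mu> - 1) * (1 / (1 - Q / r) ^ m) * exp (- (l * x))"
    proof (rule mult_left_mono)
      have "(1 - r) * a0 * x \<le> (1 - r) * a * x"
        using a x r by (intro mult_right_mono mult_left_mono) auto
      then show "exp (- ((1 - r) * a * x)) \<le> exp (- (l * x))" by (simp add: l_def)
    qed (use a a0 x r in simp)
    also have "\<dots> = C * erlang_density (\<mu> - 1) l x"
      using x l assms(1) by (simp add: C_def erlang_density_def mult_ac)
    finally show ?thesis .
  qed
  then show ?thesis using l by blast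
qed

lemma kms_density_measurable:
  fixes \<mu> m :: nat
  assumes "\<mu> > 0" "m > 0"
  shows "kms_density g \<kappa> (real \<mu>) (real m) \<in> borel_measurable borel"
proof -
  note [measurable] = kummer_1F1_measurable[OF assms(2,1)]
  show ?thesis unfolding kms_density_def[abs_def] by measurable
qed

lemma integrable_kms_density:
  fixes \<mu> m :: nat
  assumes "\<mu> > 0" "m > 0" "\<kappa> \<ge> 0" "g > 0"
  shows "integrable lborel (kms_density g \<kappa> (real \<mu>) (real m))"
proof -
  obtain C l where Cl: "l > 0"
    "\<And>k x. 0 \<le> k \<Longrightarrow> k \<le> \<kappa> \<Longrightarrow> kms_density g k (real \<mu>) (real m) x \<le> C * erlang_density (\<mu> - 1) l x"
    using kms_density_dominated[OF assms(1,2,4,3)] by blast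
  show ?thesis
  proof (rule Bochner_Integration.integrable_bound)
    show "integrable lborel (\<lambda>x. C * erlang_density (\<mu> - 1) l x)"
      using integrable_erlang_density(1)[OF Cl(1)] by simp
    show "AE x in lborel. norm (kms_density g \<kappa> (real \<mu>) (real m) x)
      \<le> norm (C * erlang_density (\<mu> - 1) l x)"
      using Cl(2)[OF assms(3) order_refl] kms_density_nonneg[OF assms]
      by (intro AE_I2) (auto intro: order_trans[OF _ abs_ge_self])
  qed (simp add: kms_density_measurable[OF assms(1,2)])
qed

lemma tendsto_kms_density:
  fixes \<mu> m :: nat
  assumes "\<mu> > 0" "m > 0" "g > 0" "\<kappa> \<ge> 0"
    and k: "k \<longlonglongrightarrow> \<kappa>" "\<And>i. k i \<ge> 0"
  shows "(\<lambda>i. kms_density g (k i) (real \<mu>) (real m) x) \<longlonglongrightarrow> kms_density g \<kappa> (real \<mu>) (real m) x"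
proof (cases "x > 0")
  case True
  have "real \<mu> * \<kappa> + real m > 0" using assms by (simp add: add_nonneg_pos)
  then show ?thesis
    unfolding kms_density_eq[OF assms(1,2) k(2) assms(3) True] kms_density_eq[OF assms(1,2,4,3)
      True]
    unfolding mix_p_def mix_q_def
    by (intro tendsto_intros k isCont_tendsto_compose[OF isCont_kummer_1F1[OF assms(2,1)]]) (use
      assms in auto)
qed (simp add: kms_density_def)

text \<open>Convergent parameter sequences are bounded, so each factor has one integrable majorant
  for all indices, and dominated convergence applies on the product space. No positivity of the
  limits is needed, which admits the singular values \<kappa> = 0.\<close>

lemma tendsto_product_cdf_kms_density:
  fixes \<mu> m \<mu>' m' :: nat
  assumes \<mu>: "\<mu> > 0" "m > 0" "g > 0" and \<mu>': "\<mu>' > 0" "m' > 0" "g' > 0"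
    and k: "k \<longlonglongrightarrow> \<kappa>" "\<And>i. k i \<ge> 0" and k': "k' \<longlonglongrightarrow> \<kappa>'" "\<And>i. k' i \<ge> 0"
  shows "(\<lambda>i. product_cdf z (kms_density g (k i) (real \<mu>) (real m)) (kms_density g' (k' i) (real \<mu>')
    (real m')))
    \<longlonglongrightarrow> product_cdf z (kms_density g \<kappa> (real \<mu>) (real m)) (kms_density g' \<kappa>' (real \<mu>') (real m'))"
proof -
  have \<kappa>: "\<kappa> \<ge> 0" "\<kappa>' \<ge> 0" using k k' by (auto intro: LIMSEQ_le_const)
  have "Bseq k" using k(1) by (intro convergent_imp_Bseq convergentI)
  then obtain K where "K > 0" "\<And>i. norm (k i) \<le> K" by (auto simp: Bseq_def)
  then have K: "\<And>i. k i \<le> K" "K \<ge> 0" by (auto simp: abs_le_iff)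
  have "Bseq k'" using k'(1) by (intro convergent_imp_Bseq convergentI)
  then obtain K' where "K' > 0" "\<And>i. norm (k' i) \<le> K'" by (auto simp: Bseq_def)
  then have K': "\<And>i. k' i \<le> K'" "K' \<ge> 0" by (auto simp: abs_le_iff)
  obtain C l where C: "l > 0"
    "\<And>\<kappa> x. 0 \<le> \<kappa> \<Longrightarrow> \<kappa> \<le> K \<Longrightarrow> kms_density g \<kappa> (real \<mu>) (real m) x \<le> C * erlang_density (\<mu> - 1) l x"
    using kms_density_dominated[OF \<mu> K(2)] by blast
  obtain C' l' where C': "l' > 0"
    "\<And>\<kappa> x. 0 \<le> \<kappa> \<Longrightarrow> \<kappa> \<le> K' \<Longrightarrow> kms_density g' \<kappa> (real \<mu>') (real m') x
      \<le> C' * erlang_density (\<mu>' - 1) l' x"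
    using kms_density_dominated[OF \<mu>' K'(2)] by blast
  note [measurable] = kms_density_measurable[OF \<mu>(1,2)] kms_density_measurable[OF \<mu>'(1,2)]
  show ?thesis unfolding product_cdf_def
  proof (rule integral_dominated_convergence)
    show "integrable (lborel \<Otimes>\<^sub>M lborel)
      (\<lambda>p. (C * erlang_density (\<mu> - 1) l (fst p)) * (C' * erlang_density (\<mu>' - 1) l' (snd p)))"
      using integrable_erlang_density(1) C(1) C'(1) by (intro integrable_product_density) simp_all
    show "AE p in lborel \<Otimes>\<^sub>M lborel. (\<lambda>i. indicator (product_region z) p
      * (kms_density g (k i) (real \<mu>) (real m) (fst p)
        * kms_density g' (k' i) (real \<mu>') (real m') (snd p)))
       \<longlonglongrightarrow> indicator (product_region z) p * (kms_density g \<kappa> (real \<mu>) (real m) (fst p)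
         * kms_density g' \<kappa>' (real \<mu>') (real m') (snd p))"
      using \<mu> \<mu>' k k' \<kappa> by (intro AE_I2 tendsto_mult tendsto_const tendsto_kms_density)
    show "AE p in lborel \<Otimes>\<^sub>M lborel. norm (indicator (product_region z) p
      * (kms_density g (k i) (real \<mu>) (real m) (fst p)
        * kms_density g' (k' i) (real \<mu>') (real m') (snd p)))
      \<le> (C * erlang_density (\<mu> - 1) l (fst p)) * (C' * erlang_density (\<mu>' - 1) l' (snd p))" for i
    proof (rule AE_I2)
      fix p :: "real \<times> real"
      let ?f = "kms_density g (k i) (real \<mu>) (real m) (fst p)" and ?f'
        = "kms_density g' (k' i) (real \<mu>') (real m') (snd p)"
      have f: "0 \<le> ?f" "?f \<le> C * erlang_density (\<mu> - 1) l (fst p)"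
        using kms_density_nonneg \<mu> k(2) C(2)[OF k(2) K(1)] by auto
      have f': "0 \<le> ?f'" "?f' \<le> C' * erlang_density (\<mu>' - 1) l' (snd p)"
        using kms_density_nonneg \<mu>' k'(2) C'(2)[OF k'(2) K'(1)] by auto
      have "norm (indicator (product_region z) p * (?f * ?f')) \<le> ?f * ?f'"
        using f f' by (auto simp: indicator_def)
      also have "\<dots> \<le> (C * erlang_density (\<mu> - 1) l (fst p)) * (C' * erlang_density (\<mu>'
        - 1) l' (snd p))"
        using f f' by (intro mult_mono) auto
      finally show "norm (indicator (product_region z) p * (?f * ?f'))
        \<le> (C * erlang_density (\<mu> - 1) l (fst p)) * (C' * erlang_density (\<mu>' - 1) l' (snd p))" .
    qed
  qed measurable
qed

section \<open>From densities to independent random variables\<close>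

text \<open>Independence gives the product as joint density, and since both factors vanish off the
  positive axis, the event reduces to \<open>product_region\<close>.\<close>

lemma (in prob_space) cdf_mult_eq_product_cdf:
  fixes X X' :: "'a \<Rightarrow> real"
  assumes X: "distributed M lborel X (\<lambda>x. ennreal (f x))" and X':
    "distributed M lborel X' (\<lambda>x. ennreal (f' x))"
    and indep: "indep_var borel X borel X'"
    and f: "integrable lborel f" "\<And>x. f x \<ge> 0" "\<And>x. x \<le> 0 \<Longrightarrow> f x = 0"
    and f': "integrable lborel f'" "\<And>x. f' x \<ge> 0" "\<And>x. x \<le> 0 \<Longrightarrow> f' x = 0"
  shows "cdf (distr M borel (\<lambda>\<omega>. X \<omega> * X' \<omega>)) z = product_cdf z f f'"
proof -
  have "indep_var lborel X lborel X'"
    using indep by (simp add: indep_var_eq)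
  then have D: "distributed M (lborel \<Otimes>\<^sub>M lborel) (\<lambda>x. (X x, X' x)) (\<lambda>(x, y). ennreal (f x)
    * ennreal (f' y))"
    by (intro distributed_joint_indep X X' lborel.sigma_finite_measure_axioms)
  have [measurable]: "X \<in> borel_measurable M" "X' \<in> borel_measurable M"
    using distributed_measurable[OF X] distributed_measurable[OF X'] by auto
  have [measurable]: "f \<in> borel_measurable borel" "f' \<in> borel_measurable borel"
    using borel_measurable_integrable f f' by auto
  define A where "A = {p :: real \<times> real. fst p * snd p \<le> z}"
  have "A = {p \<in> space (borel \<Otimes>\<^sub>M borel). fst p * snd p \<le> z}"
    by (auto simp: A_def space_pair_measure)
  also have "\<dots> \<in> sets (borel \<Otimes>\<^sub>M borel)" by simp
  finally have [measurable]: "A \<in> sets (borel \<Otimes>\<^sub>M borel)" .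
  then have A: "A \<in> sets (lborel \<Otimes>\<^sub>M lborel)" by (simp cong: sets_pair_measure_cong)
  have "ennreal (cdf (distr M borel (\<lambda>\<omega>. X \<omega> * X' \<omega>)) z)
    = emeasure M ((\<lambda>\<omega>. X \<omega> * X' \<omega>) -` {..z} \<inter> space M)"
    by (simp add: cdf_def measure_distr emeasure_eq_measure)
  also have "(\<lambda>\<omega>. X \<omega> * X' \<omega>) -` {..z} \<inter> space M = (\<lambda>x. (X x, X' x)) -` A \<inter> space M"
    by (auto simp: A_def)
  also have "emeasure M \<dots> = (\<integral>\<^sup>+p. (case p of (x, y) \<Rightarrow> ennreal (f x) * ennreal (f' y)) *
    indicator A p \<partial>(lborel \<Otimes>\<^sub>M lborel))"
    by (rule distributed_emeasure[OF D A])
  also have "\<dots> = (\<integral>\<^sup>+p. ennreal (indicator (product_region z) p * (f (fst p)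
    * f' (snd p))) \<partial>(lborel \<Otimes>\<^sub>M lborel))"
  proof (rule nn_integral_cong)
    fix p :: "real \<times> real"
    show "(case p of (x, y) \<Rightarrow> ennreal (f x) * ennreal (f' y)) * indicator A p =
      ennreal (indicator (product_region z) p * (f (fst p) * f' (snd p)))"
      using f(2,3)[of "fst p"] f'(2,3)[of "snd p"]
      by (cases "fst p > 0"; cases "snd p > 0")
         (auto simp: A_def product_region_def indicator_def ennreal_mult case_prod_beta')
  qed
  also have "\<dots> = ennreal (product_cdf z f f')"
    unfolding product_cdf_def using f f'
    by (intro nn_integral_eq_integral integrable_product_cdf) auto
  finally show ?thesis
    using f f' by (subst (asm) ennreal_inj) (auto simp: product_cdf_def cdf_def intro!:
      integral_nonneg_AE)
qed

text \<open>The equation covers the parameters for which all weights are defined. The limit also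
  covers \<kappa> = 0 with \<mu> > \<open>m\<close>; every admissible pair is a limit point of the
  domain, so it is not vacuous.\<close>

theorem proposition2:
  fixes P :: "'a measure" and X X' :: "'a \<Rightarrow> real"
    and g g' \<kappa> \<kappa>' z :: real and \<mu> m \<mu>' m' :: nat
  assumes "prob_space P"
    and "g > 0" "g' > 0" "\<kappa> \<ge> 0" "\<kappa>' \<ge> 0"
    and "\<mu> > 0" "m > 0" "\<mu>' > 0" "m' > 0"
    and "squared_kappa_mu_shadowed P X g \<kappa> (real \<mu>) (real m)"
    and "squared_kappa_mu_shadowed P X' g' \<kappa>' (real \<mu>') (real m')"
    and "prob_space.indep_var P borel X borel X'"
    and "z > 0"
  shows
    "let FZ = cdf (distr P borel (\<lambda>\<omega>. X \<omega> * X' \<omega>)) z;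
         R = (\<lambda>(k1, k2).
           \<Sum>j = 0..mix_M \<mu> m. \<Sum>h = 0..mix_M \<mu>' m'.
             mix_C k1 \<mu> m j * mix_C k2 \<mu>' m' h *
             (1 - (\<Sum>k = 0..mix_m \<mu> m j - 1.
                2 / (fact k * Gamma (real (mix_m \<mu>' m' h)))
                * (z / (mix_Omega g k1 \<mu> m j * mix_Omega g' k2 \<mu>' m' h))
                    powr ((real k + real (mix_m \<mu>' m' h)) / 2)
                * bessel_K (real (mix_m \<mu>' m' h) - real k)
                    (sqrt (4 * z / (mix_Omega g k1 \<mu> m j * mix_Omega g' k2 \<mu>' m' h))))))
     in ((\<kappa>, \<kappa>') \<in> mix_dom \<mu> m \<times> mix_dom \<mu>' m' \<longrightarrow> FZ = R (\<kappa>, \<kappa>'))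
      \<and> (R \<longlongrightarrow> FZ) (at (\<kappa>, \<kappa>') within mix_dom \<mu> m \<times> mix_dom \<mu>' m')"
proof -
  interpret prob_space P by fact
  define R where "R = (\<lambda>(k1, k2).
           \<Sum>j = 0..mix_M \<mu> m. \<Sum>h = 0..mix_M \<mu>' m'.
             mix_C k1 \<mu> m j * mix_C k2 \<mu>' m' h *
             (1 - (\<Sum>k = 0..mix_m \<mu> m j - 1.
                2 / (fact k * Gamma (real (mix_m \<mu>' m' h)))
                * (z / (mix_Omega g k1 \<mu> m j * mix_Omega g' k2 \<mu>' m' h))
                    powr ((real k + real (mix_m \<mu>' m' h)) / 2)
                * bessel_K (real (mix_m \<mu>' m' h) - real k)
                    (sqrt (4 * z / (mix_Omega g k1 \<mu> m j * mix_Omega g' k2 \<mu>' m' h))))))"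
  define FZ where "FZ = cdf (distr P borel (\<lambda>\<omega>. X \<omega> * X' \<omega>)) z"
  \<comment> \<open>\<open>F\<close> agrees with \<open>R\<close> on the domain but is also
    continuous where the weights are singular, so it carries the limit.\<close>
  define F where "F = (\<lambda>(k1, k2). product_cdf z (kms_density g k1 (real \<mu>) (real m)) (kms_density g'
    k2 (real \<mu>') (real m')))"
  have FZ: "FZ = F (\<kappa>, \<kappa>')"
    using assms
    unfolding FZ_def F_def prod.case squared_kappa_mu_shadowed_def
    by (intro cdf_mult_eq_product_cdf integrable_kms_density kms_density_nonneg) (auto simp:
      kms_density_def)
  have R: "R k = F k" if dom: "k \<in> mix_dom \<mu> m \<times> mix_dom \<mu>' m'" for k
  proof -
    obtain k1 k2 where k: "k = (k1, k2)" by (cases k)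
    have k1: "k1 \<in> mix_dom \<mu> m" "k1 \<ge> 0" and k2: "k2 \<in> mix_dom \<mu>' m'" "k2 \<ge> 0"
      using dom by (auto simp: k mix_dom_def)
    let ?e = "\<lambda>j. erlang_density (mix_m \<mu> m j - 1) (1 / mix_Omega g k1 \<mu> m j)"
    let ?e' = "\<lambda>h. erlang_density (mix_m \<mu>' m' h - 1) (1 / mix_Omega g' k2 \<mu>' m' h)"
    have \<Omega>: "mix_Omega g k1 \<mu> m j > 0" "mix_Omega g' k2 \<mu>' m' j > 0" for j
      using assms k1 k2 by (auto intro: mix_Omega_pos)
    have "F k = (\<Sum>j=0..mix_M \<mu> m. \<Sum>h=0..mix_M \<mu>' m'. mix_C k1 \<mu> m j * mix_C k2 \<mu>' m' h
      * product_cdf z (?e j) (?e' h))"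
      unfolding k F_def prod.case
    proof (rule product_cdf_sum)
      show "integrable lborel (?e j)" "integrable lborel (?e' j)" for j
        using \<Omega>[of j] by (simp_all add: integrable_erlang_density)
      show "kms_density g k1 (real \<mu>) (real m) x = (\<Sum>j=0..mix_M \<mu> m. mix_C k1 \<mu> m j * ?e j x)"
        if "x > 0" for x
        using assms k1 that by (intro kms_density_eq_mixture)
      show "kms_density g' k2 (real \<mu>') (real m') x
        = (\<Sum>h=0..mix_M \<mu>' m'. mix_C k2 \<mu>' m' h * ?e' h x)" if "x > 0" for x
        using assms k2 that by (intro kms_density_eq_mixture)
    qed
    also have "\<dots> = R k"
      unfolding k R_def prod.case
    proof (intro sum.cong refl arg_cong2[where f = "(*)"])
      fix j h assume "h \<in> {0..mix_M \<mu>' m'}"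
      \<comment> \<open>Positivity of the shape makes the \<open>Suc b\<close> of the Erlang formula
        equal to it.\<close>
      then have "Suc (mix_m \<mu>' m' h - 1) = mix_m \<mu>' m' h"
        using mix_m_pos[of \<mu>' h m'] assms by simp
      then show "product_cdf z (?e j) (?e' h) = (1 - (\<Sum>k = 0..mix_m \<mu> m j - 1.
                2 / (fact k * Gamma (real (mix_m \<mu>' m' h)))
                * (z / (mix_Omega g k1 \<mu> m j * mix_Omega g' k2 \<mu>' m' h))
                    powr ((real k + real (mix_m \<mu>' m' h)) / 2)
                * bessel_K (real (mix_m \<mu>' m' h) - real k)
                    (sqrt (4 * z / (mix_Omega g k1 \<mu> m j * mix_Omega g' k2 \<mu>' m' h)))))"
        using \<Omega> assms by (subst product_cdf_erlang) (simp_all)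
    qed
    finally show ?thesis ..
  qed
  have "(R \<longlongrightarrow> FZ) (at (\<kappa>, \<kappa>') within mix_dom \<mu> m \<times> mix_dom \<mu>' m')"
    unfolding tendsto_at_iff_sequentially
  proof (intro allI impI)
    fix S :: "nat \<Rightarrow> real \<times> real"
    assume S: "\<forall>i. S i \<in> mix_dom \<mu> m \<times> mix_dom \<mu>' m' - {(\<kappa>, \<kappa>')}" and lim: "S \<longlonglongrightarrow> (\<kappa>, \<kappa>')"
    have "(\<lambda>i. fst (S i)) \<longlonglongrightarrow> \<kappa>" "(\<lambda>i. snd (S i)) \<longlonglongrightarrow> \<kappa>'"
      using tendsto_fst[OF lim] tendsto_snd[OF lim] by auto
    moreover have "fst (S i) \<ge> 0" "snd (S i) \<ge> 0" for i
      using S[rule_format, of i] by (auto simp: mix_dom_def)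
    ultimately have "(\<lambda>i. F (S i)) \<longlonglongrightarrow> FZ"
      unfolding FZ F_def case_prod_beta fst_conv snd_conv
      using assms by (intro tendsto_product_cdf_kms_density)
    moreover have "R (S i) = F (S i)" for i using S by (intro R) auto
    ultimately show "(R \<circ> S) \<longlonglongrightarrow> FZ" by (simp add: o_def)
  qed
  then show ?thesis
    unfolding Let_def R_def[symmetric] FZ_def[symmetric] using R[of "(\<kappa>, \<kappa>')"] FZ by simp
qed

end
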